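(* For all integers $t\geq 1$ and $r\geq 3$ there exists a number $f(t,r)$ such that if $G$ is a $(30t-15)$-connected line graph with $|V(G)|\geq f(t,r)$, then $G$ contains $L(C_{t,r})$ as a minor.
   Context: All graphs are finite and loopless but may have parallel edges. For a graph $H$, the line graph $L(H)$ is the simple graph with vertex set $E(H)$ in which two distinct edges of $H$ are adjacent if and only if they share an end. A graph $G$ is a line graph if $G\cong L(H)$ for some (loopless, possibly multi-) graph $H$. A graph $J$ is a minor of $G$ if a graph isomorphic to $J$ can be obtained from a subgraph of $G$ by contracting edges. For integers $t\geq 1$, $r\geq 2$, $C_{t,r}$ denotes the graph obtained from a cycle on $r$ vertices by replacing each edge by $t$ parallel edges. *)

theory Defs
  imports Main
begin

text \<open>Finite simple graphs: a vertex set V and a set E of 2-element subsets of V.\<close>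
definition simple_graph :: "'a set \<Rightarrow> 'a set set \<Rightarrow> bool" where
  "simple_graph V E \<longleftrightarrow> finite V \<and> (\<forall>e\<in>E. e \<subseteq> V \<and> card e = 2)"

text \<open>The vertex set S induces a connected subgraph (in the edge set E).\<close>
definition connected_in :: "'a set set \<Rightarrow> 'a set \<Rightarrow> bool" where
  "connected_in E S \<longleftrightarrow>
     (\<forall>u\<in>S. \<forall>v\<in>S. (u, v) \<in> {(x, y). x \<in> S \<and> y \<in> S \<and> {x, y} \<in> E}\<^sup>*)"

text \<open>k-connectedness: more than k vertices, and deleting fewer than k vertices
  leaves a connected graph.\<close>
definition k_connected :: "'a set \<Rightarrow> 'a set set \<Rightarrow> nat \<Rightarrow> bool" where
  "k_connected V E k \<longleftrightarrow> k < card V \<and> (\<forall>X. X \<subseteq> V \<and> card X < k \<longrightarrow> connected_in E (V - X))"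

text \<open>Line graph of a loopless multigraph H given by its edge set D and an
  end-function assigning to each edge its two distinct ends.\<close>
definition line_graph_edges :: "'e set \<Rightarrow> ('e \<Rightarrow> 'v set) \<Rightarrow> 'e set set" where
  "line_graph_edges D ends =
     {{x, y} | x y. x \<in> D \<and> y \<in> D \<and> x \<noteq> y \<and> ends x \<inter> ends y \<noteq> {}}"

definition loopless_multigraph :: "'e set \<Rightarrow> ('e \<Rightarrow> 'v set) \<Rightarrow> bool" where
  "loopless_multigraph D ends \<longleftrightarrow> finite D \<and> (\<forall>x\<in>D. card (ends x) = 2)"

text \<open>G = (V,E) is a line graph: G is isomorphic to L(H) for a loopless multigraph H.
  Up to isomorphism the edges of H may be identified with V, and the (finitely many)
  vertices of H may be taken to be natural numbers.\<close>
definition is_line_graph :: "'a set \<Rightarrow> 'a set set \<Rightarrow> bool" where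
  "is_line_graph V E \<longleftrightarrow>
     (\<exists>ends :: 'a \<Rightarrow> nat set. loopless_multigraph V ends \<and> E = line_graph_edges V ends)"

text \<open>Minors of simple graphs via branch sets (models).\<close>
definition is_minor :: "'b set \<Rightarrow> 'b set set \<Rightarrow> 'a set \<Rightarrow> 'a set set \<Rightarrow> bool" where
  "is_minor VJ EJ VG EG \<longleftrightarrow>
     (\<exists>\<phi> :: 'b \<Rightarrow> 'a set.
        (\<forall>v\<in>VJ. \<phi> v \<noteq> {} \<and> \<phi> v \<subseteq> VG \<and> connected_in EG (\<phi> v)) \<and>
        (\<forall>u\<in>VJ. \<forall>v\<in>VJ. u \<noteq> v \<longrightarrow> \<phi> u \<inter> \<phi> v = {}) \<and>
        (\<forall>u\<in>VJ. \<forall>v\<in>VJ. {u, v} \<in> EJ \<longrightarrow> (\<exists>x\<in>\<phi> u. \<exists>y\<in>\<phi> v. {x, y} \<in> EG)))"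

text \<open>The multigraph C_{t,r}: vertices 0..r-1 on a cycle, edge (i,j) (j<t) is the j-th
  parallel copy of the cycle edge between i and (i+1) mod r.\<close>
definition C_edges :: "nat \<Rightarrow> nat \<Rightarrow> (nat \<times> nat) set" where
  "C_edges t r = {0..<r} \<times> {0..<t}"

definition C_ends :: "nat \<Rightarrow> nat \<times> nat \<Rightarrow> nat set" where
  "C_ends r e = {fst e, (fst e + 1) mod r}"

definition LC_V :: "nat \<Rightarrow> nat \<Rightarrow> (nat \<times> nat) set" where
  "LC_V t r = C_edges t r"

definition LC_E :: "nat \<Rightarrow> nat \<Rightarrow> (nat \<times> nat) set set" where
  "LC_E t r = line_graph_edges (C_edges t r) (C_ends r)"

end

(* Let G = L(H), k = 30t - 15. If H has a vertex of degree at least rt, its star is a clique of G that contains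
   L(C_{t,r}). Otherwise degrees in H are bounded. Call a vertex big if its degree is at least
   15t - 6; as G has minimum degree at least k, every edge of H has a big end, and there are many big vertices.
   Any set of big vertices is separated from the others by no fewer than 15t - 6 edges, where a
   small vertex may be placed on either side. Splitting off pairs of edges at small vertices (Lovasz, Mader)
   keeps this bound and leaves small vertices of degree at most three. Hence the number of resulting
   hyperedges that cross a partition of the big vertices is at least a third of the sum of the cuts of its
   classes, which is at least 3t times the number of classes. Hyperedges are trimmed to pairs keeping
   partition connectivity (Frank, by uncrossing tight partitions), and the theorem of Tutte and Nash-Williams
   gives 3t disjoint connected spanning systems on the big vertices.
   A connected graph of bounded degree with many marked vertices contains a comb, that is a long
   sequence of disjoint connected marked sets, consecutive ones adjacent. With Ramsey's theorem there are big
   vertices z 0, ..., z (r - 1) that lie in this order on combs of all 3t systems. One group of t systems,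
   taken in full, gives the branch sets of one column of C_{t,r}; the other two groups alternately give the columns
   c >= 1, cut to the segments from z (c - 1) to z c. Consecutive columns share z c. *)
theory Submission
  imports Defs "HOL-Library.Ramsey"
begin

text \<open>Vertices of \<open>G\<close> are edges of \<open>H\<close>, so branch sets are
  edge-disjoint connected subgraphs of \<open>H\<close>, and two of them that meet in a vertex of
  \<open>H\<close> are adjacent in \<open>G\<close>. Hence columns may share big vertices. The
  obstacle is that connectivity of \<open>G\<close> says little about edge cuts of \<open>H\<close>
  around vertices of small degree: only cuts between big vertices are controlled, and small vertices
  must disappear without spoiling these. Splitting off stops at degree three, and the three-element
  hyperedges that remain cost the factor 3 between cuts and partition connectivity.

  Constants: an edge with ends of degrees a and b has at most a + b - 2 neighbours in
  \<open>G\<close>, so a + b is at least 30t - 13 and one end has degree at least 15t - 6. The same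
  number serves as cut bound, since fewer deletions cannot swallow the star of a big vertex. Packing
  3t systems takes cuts of size 3 times 3t, and 15t - 6 is at least 9t, with equality at t = 1. Two
  groups of systems are enough for the columns after the first because the segments of columns c and
  c + 2 are already disjoint within one system.\<close>

section \<open>Equivalence closures and class counts\<close>

definition eqcl :: "'b set \<Rightarrow> 'b rel \<Rightarrow> 'b rel" where
  "eqcl B F = \<Inter>{R. equiv B R \<and> F \<inter> B \<times> B \<subseteq> R}"

definition merge :: "'b rel \<Rightarrow> 'b \<Rightarrow> 'b \<Rightarrow> 'b rel" where
  "merge R a b = R \<union> {(x, y). (x, a) \<in> R \<and> (b, y) \<in> R} \<union> {(x, y). (x, b) \<in> R \<and> (a, y) \<in> R}"

text \<open>When \<open>R\<close> is the closure of an edge set, this is its number of components,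
  and \<open>card B\<close> minus it is the rank in the graphic matroid. The lemmas below are rank
  facts in this form.\<close>

definition ncl :: "'b set \<Rightarrow> 'b rel \<Rightarrow> nat" where
  "ncl B R = card (B // R)"

lemma equiv_times: "equiv B (B \<times> B)"
  by (auto simp: equiv_def refl_on_def sym_def trans_def)

lemma equiv_Int: "equiv B R \<Longrightarrow> equiv B S \<Longrightarrow> equiv B (R \<inter> S)"
  unfolding equiv_def refl_on_def sym_def trans_def by blast

lemma equiv_eqcl: "equiv B (eqcl B F)"
proof -
  have t: "B \<times> B \<in> {R. equiv B R \<and> F \<inter> B \<times> B \<subseteq> R}"
    using equiv_times by auto
  show ?thesis
  proof (rule equivI)
    show "eqcl B F \<subseteq> B \<times> B"
      using t unfolding eqcl_def by blast
    show "refl_on B (eqcl B F)"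
      unfolding eqcl_def equiv_def refl_on_def by blast
    show "sym (eqcl B F)"
      unfolding eqcl_def equiv_def sym_def by blast
    show "trans (eqcl B F)"
      unfolding eqcl_def equiv_def trans_def by blast
  qed
qed

lemma eqcl_least: "equiv B R \<Longrightarrow> F \<inter> B \<times> B \<subseteq> R \<Longrightarrow> eqcl B F \<subseteq> R"
  unfolding eqcl_def by blast

lemma eqcl_upper: "F \<inter> B \<times> B \<subseteq> eqcl B F"
  unfolding eqcl_def by blast

lemma eqcl_subset_times: "eqcl B F \<subseteq> B \<times> B"
  using equiv_eqcl[of B F] by (auto simp: equiv_def)

lemma eqcl_mono: "F \<subseteq> G \<Longrightarrow> eqcl B F \<subseteq> eqcl B G"
  unfolding eqcl_def by blast

lemma eqcl_equiv: "equiv B R \<Longrightarrow> eqcl B R = R"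
  using eqcl_least[of B R R] eqcl_upper[of R B] by (auto simp: equiv_def)

lemma equiv_Id_on: "equiv B (Id_on B)"
  by (auto simp: equiv_def refl_on_def sym_def trans_def)

lemma eqcl_empty: "eqcl B {} = Id_on B"
  using eqcl_least[OF equiv_Id_on, of "{}" B] equiv_eqcl[of B "{}"]
  by (auto simp: equiv_def refl_on_def)

lemma equiv_symD: "equiv B R \<Longrightarrow> (x, y) \<in> R \<Longrightarrow> (y, x) \<in> R"
  by (auto simp: equiv_def sym_def)

lemma equiv_transD: "equiv B R \<Longrightarrow> (x, y) \<in> R \<Longrightarrow> (y, z) \<in> R \<Longrightarrow> (x, z) \<in> R"
  unfolding equiv_def trans_def by blast

lemma equiv_reflD: "equiv B R \<Longrightarrow> x \<in> B \<Longrightarrow> (x, x) \<in> R"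
  by (auto simp: equiv_def refl_on_def)

lemma equiv_merge:
  assumes "equiv B R" "a \<in> B" "b \<in> B"
  shows "equiv B (merge R a b)"
proof (rule equivI)
  show "merge R a b \<subseteq> B \<times> B"
    using assms unfolding merge_def equiv_def by blast
  show "refl_on B (merge R a b)"
    using assms unfolding merge_def equiv_def refl_on_def by blast
  show "sym (merge R a b)"
    using assms(1) unfolding merge_def equiv_def sym_def by blast
  show "trans (merge R a b)"
  proof (rule transI)
    have sy: "(x, y) \<in> R \<longleftrightarrow> (y, x) \<in> R" for x y
      using equiv_symD[OF assms(1)] by blast
    note t = equiv_transD[OF assms(1)]
    fix x y z
    assume xy: "(x, y) \<in> merge R a b" and yz: "(y, z) \<in> merge R a b"
    have c: "(x, u) \<in> R \<longleftrightarrow> (y, u) \<in> R" if "(x, y) \<in> R" for x y u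
      using that t[of x y u] t[of y x u] sy[of x y] by blast
    from xy consider "(x, y) \<in> R" | "(x, a) \<in> R" "(y, b) \<in> R" | "(x, b) \<in> R" "(y, a) \<in> R"
      unfolding merge_def using sy by blast
    then show "(x, z) \<in> merge R a b"
    proof cases
      case 1
      then show ?thesis using yz c[OF 1] unfolding merge_def by simp
    next
      case 2
      from yz consider "(y, z) \<in> R" | "(y, a) \<in> R" "(b, z) \<in> R" | "(y, b) \<in> R" "(a, z) \<in> R"
        unfolding merge_def by blast
      then show ?thesis
        using 2 sy[of y b] t[of x a z] t[of b y z] unfolding merge_def by cases auto
    next
      case 3
      from yz consider "(y, z) \<in> R" | "(y, a) \<in> R" "(b, z) \<in> R" | "(y, b) \<in> R" "(a, z) \<in> R"
        unfolding merge_def by blast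
      then show ?thesis
        using 3 sy[of y a] t[of x b z] t[of a y z] unfolding merge_def by cases auto
    qed
  qed
qed

lemma eqcl_insert:
  assumes "a \<in> B" "b \<in> B"
  shows "eqcl B (insert (a, b) F) = merge (eqcl B F) a b"
proof
  have aa: "(a, a) \<in> eqcl B F" "(b, b) \<in> eqcl B F"
    using equiv_reflD[OF equiv_eqcl assms(1)] equiv_reflD[OF equiv_eqcl assms(2)] .
  show "eqcl B (insert (a, b) F) \<subseteq> merge (eqcl B F) a b"
  proof (rule eqcl_least[OF equiv_merge[OF equiv_eqcl assms]])
    show "insert (a, b) F \<inter> B \<times> B \<subseteq> merge (eqcl B F) a b"
      using aa eqcl_upper[of F B] unfolding merge_def by blast
  qed
  let ?R = "eqcl B (insert (a, b) F)"
  have ab: "(a, b) \<in> ?R"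
    using eqcl_upper[of "insert (a, b) F" B] assms by auto
  have sub: "eqcl B F \<subseteq> ?R"
    by (rule eqcl_mono) auto
  note t = equiv_transD[OF equiv_eqcl]
  have "(x, y) \<in> ?R" if "(x, a) \<in> eqcl B F" "(b, y) \<in> eqcl B F" for x y
    using that sub ab t[of x a B "insert (a, b) F" b] t[of x b B "insert (a, b) F" y] by blast
  moreover have "(x, y) \<in> ?R" if "(x, b) \<in> eqcl B F" "(a, y) \<in> eqcl B F" for x y
    using that sub equiv_symD[OF equiv_eqcl ab]
      t[of x b B "insert (a, b) F" a] t[of x a B "insert (a, b) F" y] by blast
  ultimately show "merge (eqcl B F) a b \<subseteq> ?R"
    using sub unfolding merge_def by blast
qed

lemma merge_absorb: "equiv B R \<Longrightarrow> (a, b) \<in> R \<Longrightarrow> merge R a b = R"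
  unfolding merge_def using equiv_transD[of B R] equiv_symD[of B R] by blast

text \<open>The exchange property of the graphic matroid: adding \<open>(c, d)\<close> joins only
  the classes of \<open>c\<close> and \<open>d\<close>, so \<open>a\<close> and \<open>b\<close> lie
  one in each, and joining \<open>a\<close> to \<open>b\<close> joins the same two classes.\<close>

lemma eqcl_exchange:
  assumes "a \<in> B" "b \<in> B" "c \<in> B" "d \<in> B"
    and "(a, b) \<in> eqcl B (insert (c, d) F)" "(a, b) \<notin> eqcl B F"
  shows "(c, d) \<in> eqcl B (insert (a, b) F)"
proof -
  have "(a, c) \<in> eqcl B F \<and> (d, b) \<in> eqcl B F \<or> (a, d) \<in> eqcl B F \<and> (c, b) \<in> eqcl B F"
    using assms unfolding eqcl_insert[OF assms(3,4)] merge_def by auto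
  then show ?thesis
    unfolding eqcl_insert[OF assms(1,2)] merge_def
    using equiv_symD[OF equiv_eqcl, of a c B F] equiv_symD[OF equiv_eqcl, of a d B F]
      equiv_symD[OF equiv_eqcl, of d b B F] equiv_symD[OF equiv_eqcl, of c b B F] by auto
qed

lemma ncl_merge:
  assumes "finite B" "equiv B R" "a \<in> B" "b \<in> B" "(a, b) \<notin> R"
  shows "ncl B R = ncl B (merge R a b) + 1"
proof -
  let ?a = "R `` {a}" and ?b = "R `` {b}"
  let ?A = "B // R - {?a, ?b}"
  have ne: "?a \<noteq> ?b"
    using assms equiv_class_eq_iff by fastforce
  have in_ab: "?a \<in> B // R" "?b \<in> B // R"
    using assms by (auto intro: quotientI)
  have cl: "merge R a b `` {x} = (if (x, a) \<in> R \<or> (x, b) \<in> R then ?a \<union> ?b else R `` {x})" for x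
  proof (cases "(x, a) \<in> R \<or> (x, b) \<in> R")
    case True
    then have "R `` {x} = ?a \<or> R `` {x} = ?b"
      using equiv_class_eq[OF assms(2)] by blast
    then have "R `` {x} \<subseteq> ?a \<union> ?b" by blast
    moreover have "?a \<subseteq> R `` {x} \<or> (x, b) \<in> R" "?b \<subseteq> R `` {x} \<or> (x, a) \<in> R"
      using True equiv_class_eq[OF assms(2)] by blast+
    ultimately show ?thesis using True unfolding merge_def by auto
  next
    case False
    then show ?thesis unfolding merge_def by auto
  qed
  have eqA: "R `` {x} \<noteq> ?a \<and> R `` {x} \<noteq> ?b \<longleftrightarrow> \<not> ((x, a) \<in> R \<or> (x, b) \<in> R)" if "x \<in> B" for x
    using that assms eq_equiv_class_iff[OF assms(2)] by blast
  have "B // merge R a b = insert (?a \<union> ?b) ?A"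
  proof
    show "B // merge R a b \<subseteq> insert (?a \<union> ?b) ?A"
    proof
      fix X assume "X \<in> B // merge R a b"
      then obtain x where x: "x \<in> B" "X = merge R a b `` {x}"
        by (auto elim: quotientE)
      show "X \<in> insert (?a \<union> ?b) ?A"
        using x eqA[of x] cl[of x] quotientI[of x B R] by auto
    qed
    have "?a \<union> ?b \<in> B // merge R a b"
      using quotientI[OF assms(3), of "merge R a b"] cl[of a] equiv_reflD[OF assms(2,3)] by auto
    moreover have "?A \<subseteq> B // merge R a b"
    proof
      fix X assume X: "X \<in> ?A"
      then obtain x where x: "x \<in> B" "X = R `` {x}"
        by (auto elim: quotientE)
      then have "X = merge R a b `` {x}"
        using X eqA[of x] cl[of x] by auto
      then show "X \<in> B // merge R a b"
        using x quotientI by metis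
    qed
    ultimately show "insert (?a \<union> ?b) ?A \<subseteq> B // merge R a b" by auto
  qed
  moreover have "?a \<union> ?b \<notin> ?A"
  proof
    assume "?a \<union> ?b \<in> ?A"
    then obtain x where x: "x \<in> B" "?a \<union> ?b = R `` {x}" "R `` {x} \<noteq> ?a"
      by (elim DiffE quotientE) auto
    then have "(x, a) \<in> R" using equiv_reflD[OF assms(2,3)] by auto
    then show False using x equiv_class_eq[OF assms(2)] by blast
  qed
  moreover have fin: "finite (B // R)"
    using assms by (auto intro: finite_quotient simp: equiv_def)
  ultimately have "ncl B (merge R a b) = card ?A + 1"
    unfolding ncl_def by simp
  moreover have "card (B // R) = card ?A + 2"
  proof -
    have "B // R = insert ?a (insert ?b ?A)" using in_ab by auto
    moreover have "card (insert ?a (insert ?b ?A)) = card ?A + 2"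
      using ne fin by (simp del: insert_Diff_single)
    ultimately show ?thesis by simp
  qed
  ultimately show ?thesis unfolding ncl_def by simp
qed

lemma ncl_insert_le:
  assumes "finite B" "a \<in> B" "b \<in> B"
  shows "ncl B (eqcl B F) \<le> ncl B (eqcl B (insert (a, b) F)) + 1"
  using ncl_merge[OF assms(1) equiv_eqcl assms(2,3)] merge_absorb[OF equiv_eqcl]
  unfolding eqcl_insert[OF assms(2,3)] by (cases "(a, b) \<in> eqcl B F") fastforce+

lemma eqcl_insert_absorb:
  assumes "a \<in> B" "b \<in> B" "(a, b) \<in> eqcl B F"
  shows "eqcl B (insert (a, b) F) = eqcl B F"
  unfolding eqcl_insert[OF assms(1,2)] by (rule merge_absorb[OF equiv_eqcl assms(3)])

lemma ncl_insert_eq: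
  assumes "finite B" "a \<in> B" "b \<in> B" "(a, b) \<notin> eqcl B F"
  shows "ncl B (eqcl B F) = ncl B (eqcl B (insert (a, b) F)) + 1"
  using ncl_merge[OF assms(1) equiv_eqcl assms(2-4)]
  unfolding eqcl_insert[OF assms(2,3)] .

lemma ncl_Id_on: "finite B \<Longrightarrow> ncl B (Id_on B) = card B"
proof -
  have "B // Id_on B = (\<lambda>x. {x}) ` B"
    by (auto simp: quotient_def Id_on_def)
  then show ?thesis unfolding ncl_def by (simp add: card_image)
qed

lemma ncl_ge_1:
  assumes "finite B" "B \<noteq> {}" "equiv B R"
  shows "ncl B R \<ge> 1"
proof -
  have "finite (B // R)" using assms by (auto intro: finite_quotient simp: equiv_def)
  moreover have "B // R \<noteq> {}" using assms(2) by (auto simp: quotient_def)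
  ultimately show ?thesis unfolding ncl_def by (simp add: Suc_leI card_gt_0_iff)
qed

lemma ncl_eq_1D:
  assumes "equiv B R" "ncl B R = 1"
  shows "R = B \<times> B"
proof -
  obtain C where C: "B // R = {C}" using assms(2) unfolding ncl_def by (auto simp: card_1_singleton_iff)
  have "(x, y) \<in> R" if "x \<in> B" "y \<in> B" for x y
    using that C quotientI[of x B R] quotientI[of y B R] eq_equiv_class_iff[OF assms(1)] by auto
  then show ?thesis using assms(1) by (auto simp: equiv_def)
qed

text \<open>Submodularity of rank as diminishing returns: a pair that merges two classes over the
  larger set \<open>R\<close> also does so over \<open>Q\<close>. Sums on both sides avoid truncated
  subtraction.\<close>

lemma ncl_drop_mono:
  assumes "finite B" "finite F" "F \<subseteq> B \<times> B" "Q \<subseteq> R"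
  shows "ncl B (eqcl B R) + ncl B (eqcl B (Q \<union> F)) \<le> ncl B (eqcl B Q) + ncl B (eqcl B (R \<union> F))"
  using assms(2,3)
proof (induction F rule: finite_induct)
  case empty
  then show ?case by simp
next
  case (insert e F)
  obtain a b where e: "e = (a, b)" "a \<in> B" "b \<in> B" using insert.prems by auto
  have IH: "ncl B (eqcl B R) + ncl B (eqcl B (Q \<union> F)) \<le> ncl B (eqcl B Q) + ncl B (eqcl B (R \<union> F))"
    using insert by auto
  show ?case
  proof (cases "(a, b) \<in> eqcl B (Q \<union> F)")
    case True
    moreover have "(a, b) \<in> eqcl B (R \<union> F)"
      using True eqcl_mono[of "Q \<union> F" "R \<union> F" B] assms(4) by blast
    ultimately show ?thesis using IH e by (simp add: eqcl_insert_absorb)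
  next
    case False
    then show ?thesis
      using IH e ncl_insert_eq[OF assms(1) e(2,3) False] ncl_insert_le[OF assms(1) e(2,3), of "R \<union> F"]
      by simp
  qed
qed

lemma ncl_supermodular:
  assumes "finite B" "equiv B R1" "equiv B R2"
  shows "ncl B R1 + ncl B R2 \<le> ncl B (R1 \<inter> R2) + ncl B (eqcl B (R1 \<union> R2))"
proof -
  have "finite R2" "R2 \<subseteq> B \<times> B"
    using assms finite_subset[of R2 "B \<times> B"] by (auto simp: equiv_def)
  from ncl_drop_mono[OF assms(1) this, of "R1 \<inter> R2" R1]
  show ?thesis
    using assms by (simp add: eqcl_equiv equiv_Int Un_absorb1)
qed

section \<open>Trimming hyperedges to pairs\<close>

definition crossing :: "'i set \<Rightarrow> ('i \<Rightarrow> 'b set) \<Rightarrow> 'b rel \<Rightarrow> 'i set" where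
  "crossing I h R = {i \<in> I. \<not> h i \<times> h i \<subseteq> R}"

text \<open>The Tutte--Nash-Williams condition for hyperedges, with \<open>p\<close> times (classes
  minus one) as the bound; one \<open>p\<close> is moved to the right because subtraction on
  \<open>nat\<close> truncates.\<close>

definition partition_connected :: "'b set \<Rightarrow> 'i set \<Rightarrow> ('i \<Rightarrow> 'b set) \<Rightarrow> nat \<Rightarrow> bool" where
  "partition_connected B I h p \<longleftrightarrow>
     (\<forall>R. equiv B R \<longrightarrow> p * ncl B R \<le> card (crossing I h R) + p)"

text \<open>Deleting \<open>a\<close> affects only whether \<open>i\<close> crosses, so the count
  falls by at most one. A partition violated afterwards was therefore tight before, and
  \<open>i\<close> crossed it only because of \<open>a\<close>.\<close>

lemma trim_tight:
  assumes "finite I" "i \<in> I" "partition_connected B I h p"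
    and bad: "\<not> partition_connected B I (h(i := h i - {a})) p"
  obtains R where "equiv B R" "p * ncl B R = card (crossing I h R) + p"
    "i \<in> crossing I h R" "(h i - {a}) \<times> (h i - {a}) \<subseteq> R"
proof -
  let ?h = "h(i := h i - {a})"
  obtain R where R: "equiv B R" "p * ncl B R > card (crossing I ?h R) + p"
    using bad unfolding partition_connected_def by (auto simp: not_le)
  have le: "p * ncl B R \<le> card (crossing I h R) + p"
    using assms(3) R(1) unfolding partition_connected_def by auto
  have sub: "crossing I h R - {i} \<subseteq> crossing I ?h R"
    unfolding crossing_def by auto
  have fin: "finite (crossing I ?h R)" "finite (crossing I h R)"
    using assms(1) unfolding crossing_def by auto
  have i: "i \<in> crossing I h R"
  proof (rule ccontr)
    assume "i \<notin> crossing I h R"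
    then have "crossing I h R \<subseteq> crossing I ?h R" using sub by auto
    from card_mono[OF fin(1) this] show False using le R(2) by linarith
  qed
  have ni: "i \<notin> crossing I ?h R"
  proof
    assume "i \<in> crossing I ?h R"
    then have "crossing I h R \<subseteq> crossing I ?h R" using sub by auto
    from card_mono[OF fin(1) this] show False using le R(2) by linarith
  qed
  have "card (crossing I h R) - 1 \<le> card (crossing I ?h R)"
    using card_mono[OF fin(1) sub] i by (simp add: fin)
  then have "p * ncl B R = card (crossing I h R) + p"
    using le R(2) by linarith
  moreover have "(h i - {a}) \<times> (h i - {a}) \<subseteq> R"
    using ni assms(2) unfolding crossing_def by auto
  ultimately show ?thesis using that R(1) i by blast
qed

text \<open>If neither a nor b can be removed from \<open>h i\<close>, two tight partitions cross: i crosses both of them but not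
  their join, so uncrossing gains one hyperedge too many.\<close>

lemma trim_step:
  assumes "finite B" "finite I" "i \<in> I" "h i \<subseteq> B" "card (h i) \<ge> 3"
    and pc: "partition_connected B I h p"
  shows "\<exists>a\<in>h i. partition_connected B I (h(i := h i - {a})) p"
proof (rule ccontr)
  assume "\<not> ?thesis"
  then have bad: "\<not> partition_connected B I (h(i := h i - {a})) p" if "a \<in> h i" for a
    using that by blast
  obtain a b c where abc: "a \<in> h i" "b \<in> h i" "c \<in> h i" "a \<noteq> b" "a \<noteq> c" "b \<noteq> c"
  proof -
    obtain T where "T \<subseteq> h i" "card T = 3" using obtain_subset_with_card_n[OF assms(5)] by blast
    then show ?thesis using that by (auto simp: card_3_iff)
  qed
  obtain R1 where R1: "equiv B R1" "p * ncl B R1 = card (crossing I h R1) + p"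
    "i \<in> crossing I h R1" "(h i - {a}) \<times> (h i - {a}) \<subseteq> R1"
    using trim_tight[where h = h, OF assms(2,3) pc bad[OF abc(1)]] .
  obtain R2 where R2: "equiv B R2" "p * ncl B R2 = card (crossing I h R2) + p"
    "i \<in> crossing I h R2" "(h i - {b}) \<times> (h i - {b}) \<subseteq> R2"
    using trim_tight[where h = h, OF assms(2,3) pc bad[OF abc(2)]] .
  let ?M = "R1 \<inter> R2" and ?J = "eqcl B (R1 \<union> R2)"
  let ?cr = "crossing I h"
  have J: "R1 \<subseteq> ?J" "R2 \<subseteq> ?J" "equiv B ?J"
    using eqcl_upper[of "R1 \<union> R2" B] R1(1) R2(1) equiv_eqcl by (auto simp: equiv_def)
  have fin: "finite (?cr R)" for R using assms(2) unfolding crossing_def by auto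
  \<comment> \<open>Here three elements matter: \<open>c\<close> survives both removals, so
    \<open>R1\<close> links it to everything in \<open>h i\<close> but \<open>a\<close>, and
    \<open>R2\<close> to everything but \<open>b\<close>.\<close>
  have cJ: "(x, c) \<in> ?J" if "x \<in> h i" for x
  proof (cases "x = a")
    case True
    then have "(x, c) \<in> R2" using abc R2(4) by auto
    then show ?thesis using J by auto
  next
    case False
    then have "(x, c) \<in> R1" using abc R1(4) that by auto
    then show ?thesis using J by auto
  qed
  have "h i \<times> h i \<subseteq> ?J"
  proof clarify
    fix x y assume "x \<in> h i" "y \<in> h i"
    then show "(x, y) \<in> ?J"
      using cJ[of x] cJ[of y] equiv_transD[OF J(3)] equiv_symD[OF J(3)] by blast
  qed
  then have niJ: "i \<notin> ?cr ?J" unfolding crossing_def by auto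
  have "?cr ?J \<subseteq> ?cr R1 \<inter> ?cr R2 - {i}"
    using J niJ unfolding crossing_def by auto
  from card_mono[OF _ this] have "card (?cr ?J) \<le> card (?cr R1 \<inter> ?cr R2) - 1"
    using fin R1(3) R2(3) by simp
  moreover have "card (?cr R1 \<inter> ?cr R2) \<ge> 1"
    using fin R1(3) R2(3) by (metis One_nat_def Suc_leI card_gt_0_iff empty_iff finite_Int Int_iff)
  moreover have "?cr ?M = ?cr R1 \<union> ?cr R2"
    unfolding crossing_def by auto
  ultimately have "card (?cr ?M) + card (?cr ?J) < card (?cr R1) + card (?cr R2)"
    using card_Un_Int[OF fin[of R1] fin[of R2]] by simp
  moreover have "p * ncl B ?M \<le> card (?cr ?M) + p" "p * ncl B ?J \<le> card (?cr ?J) + p"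
    using pc equiv_Int[OF R1(1) R2(1)] J(3) unfolding partition_connected_def by auto
  moreover have "p * ncl B R1 + p * ncl B R2 \<le> p * ncl B ?M + p * ncl B ?J"
    using mult_le_mono2[OF ncl_supermodular[OF assms(1) R1(1) R2(1)], of p]
    by (simp add: distrib_left)
  ultimately show False using R1(2) R2(2) by linarith
qed

text \<open>A family of nonempty subsets of least total size that keeps the condition has members of
  at most two elements, since \<open>trim_step\<close> would shrink a larger one. Singletons become
  loops, which cross no partition.\<close>

theorem trimming:
  assumes "finite B" "finite I" "\<And>i. i \<in> I \<Longrightarrow> h i \<subseteq> B \<and> h i \<noteq> {}"
    and "partition_connected B I h p"
  obtains \<epsilon> where "\<And>i. i \<in> I \<Longrightarrow> \<epsilon> i \<in> h i \<times> h i"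
    "\<And>R. equiv B R \<Longrightarrow> p * ncl B R \<le> card {i \<in> I. \<epsilon> i \<notin> R} + p"
proof -
  define P where "P g \<longleftrightarrow> (\<forall>i\<in>I. g i \<subseteq> h i \<and> g i \<noteq> {}) \<and> partition_connected B I g p" for g
  have "P h" using assms unfolding P_def by auto
  then obtain g where g: "P g" and min: "\<And>g'. P g' \<Longrightarrow> (\<Sum>i\<in>I. card (g i)) \<le> (\<Sum>i\<in>I. card (g' i))"
    using ex_has_least_nat[of P h "\<lambda>g. \<Sum>i\<in>I. card (g i)"] by blast
  have fin: "finite (g i)" if "i \<in> I" for i
    using g assms(1) assms(3)[of i] that finite_subset[of "g i" B] unfolding P_def by blast
  have le2: "card (g i) \<le> 2" if i: "i \<in> I" for i
  proof (rule ccontr)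
    assume "\<not> card (g i) \<le> 2"
    then have c3: "card (g i) \<ge> 3" by simp
    have gB: "g i \<subseteq> B" using g assms(3)[OF i] i unfolding P_def by blast
    obtain a where a: "a \<in> g i" "partition_connected B I (g(i := g i - {a})) p"
      using trim_step[where h = g, OF assms(1,2) i gB c3] g unfolding P_def by blast
    have "card (g i - {a}) < card (g i)"
      using a fin[OF i] by (meson card_Diff1_less)
    moreover have "g i - {a} \<noteq> {}"
      using c3 a card_Diff_singleton[of a "g i"] by (metis card.empty diff_is_0_eq not_less_eq_eq numeral_3_eq_3 One_nat_def Suc_1 le_refl le_SucI Suc_leD)
    ultimately have "P (g(i := g i - {a}))"
      using g a(2) unfolding P_def by auto
    from min[OF this] have "(\<Sum>j\<in>I. card (g j)) \<le> (\<Sum>j\<in>I. card ((g(i := g i - {a})) j))" .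
    moreover have "(\<Sum>j\<in>I. card ((g(i := g i - {a})) j)) < (\<Sum>j\<in>I. card (g j))"
      using \<open>card (g i - {a}) < card (g i)\<close> i assms(2)
      by (intro sum_strict_mono_ex1) auto
    ultimately show False by simp
  qed
  have "\<exists>x y. g i = {x, y}" if "i \<in> I" for i
  proof -
    have "card (g i) = 1 \<or> card (g i) = 2"
      using le2[OF that] fin[OF that] g that unfolding P_def
      by (metis card_0_eq le_Suc_eq le_zero_eq numeral_2_eq_2 One_nat_def)
    then show ?thesis by (auto simp: card_1_singleton_iff card_2_iff)
  qed
  then obtain x y where xy: "\<And>i. i \<in> I \<Longrightarrow> g i = {x i, y i}" by metis
  show ?thesis
  proof (rule that[of "\<lambda>i. (x i, y i)"])
    show "(x i, y i) \<in> h i \<times> h i" if "i \<in> I" for i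
      using g xy[OF that] that unfolding P_def by auto
    fix R assume R: "equiv B R"
    have "crossing I g R \<subseteq> {i \<in> I. (x i, y i) \<notin> R}"
    proof
      fix i assume i: "i \<in> crossing I g R"
      then have iI: "i \<in> I" unfolding crossing_def by auto
      then have "x i \<in> B" "y i \<in> B" using g xy[OF iI] assms(3)[OF iI] unfolding P_def by blast+
      then show "i \<in> {i \<in> I. (x i, y i) \<notin> R}"
        using i xy[OF iI] equiv_reflD[OF R] equiv_symD[OF R] unfolding crossing_def by auto
    qed
    from card_mono[OF _ this] have "card (crossing I g R) \<le> card {i \<in> I. (x i, y i) \<notin> R}"
      using assms(2) by simp
    then show "p * ncl B R \<le> card {i \<in> I. (x i, y i) \<notin> R} + p"
      using g R unfolding P_def partition_connected_def by (meson add_le_mono1 le_trans)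
  qed
qed

section \<open>Packing disjoint spanning systems\<close>

lemma ncl_rank_step:
  assumes "finite B" "finite H" "\<epsilon> ` H \<subseteq> B \<times> B"
  shows "ncl B (eqcl B (\<epsilon> ` G)) \<le> ncl B (eqcl B (\<epsilon> ` (G \<union> H))) + card H"
  using assms(2,3)
proof (induction H rule: finite_induct)
  case empty
  then show ?case by simp
next
  case (insert x H)
  obtain a b where ab: "\<epsilon> x = (a, b)" "a \<in> B" "b \<in> B" using insert.prems by auto
  show ?case
    using insert ncl_insert_le[OF assms(1) ab(2,3), of "\<epsilon> ` (G \<union> H)"] ab(1) by simp
qed

locale packing =
  fixes B :: "'b set" and I :: "'i set" and \<epsilon> :: "'i \<Rightarrow> 'b \<times> 'b" and p :: nat
  assumes finB: "finite B" and neB: "B \<noteq> {}" and finI: "finite I"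
    and ends: "\<And>i. i \<in> I \<Longrightarrow> \<epsilon> i \<in> B \<times> B" and p: "p \<ge> 1"
    and cond: "\<And>R. equiv B R \<Longrightarrow> p * ncl B R \<le> card {i \<in> I. \<epsilon> i \<notin> R} + p"
begin

text \<open>Forests, by counting: every edge lowers the number of components by exactly one.\<close>

definition indep :: "'i set \<Rightarrow> bool" where
  "indep F \<longleftrightarrow> card F + ncl B (eqcl B (\<epsilon> ` F)) = card B"

definition valid :: "(nat \<Rightarrow> 'i set) \<Rightarrow> bool" where
  "valid F \<longleftrightarrow> (\<forall>j<p. F j \<subseteq> I \<and> indep (F j)) \<and> (\<forall>j<p. \<forall>k<p. j \<noteq> k \<longrightarrow> F j \<inter> F k = {})"

definition weight :: "(nat \<Rightarrow> 'i set) \<Rightarrow> nat" where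
  "weight F = (\<Sum>j<p. card (F j))"

definition maximal :: "(nat \<Rightarrow> 'i set) \<Rightarrow> bool" where
  "maximal F \<longleftrightarrow> valid F \<and> (\<forall>G. valid G \<longrightarrow> weight G \<le> weight F)"

text \<open>The stable value of this sequence is the partition for which the counting condition is tight; it takes
  the place of Kaiser's sequence of partitions in his proof of the Tutte--Nash-Williams theorem.\<close>

fun refine :: "(nat \<Rightarrow> 'i set) \<Rightarrow> nat \<Rightarrow> 'b rel" where
  "refine F 0 = B \<times> B"
| "refine F (Suc n) = (\<Inter>j<p. eqcl B (\<epsilon> ` F j \<inter> refine F n))"

text \<open>An edge lowers the class count by at most one. \<open>F\<close> attains this bound in
  full, hence so does each of its parts.\<close>

lemma indep_subset:
  assumes "indep F" "G \<subseteq> F" "F \<subseteq> I"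
  shows "indep G"
proof -
  have fin: "finite F" "finite G" using assms finI finite_subset by metis+
  have "\<epsilon> ` F \<subseteq> B \<times> B" using assms ends by blast
  moreover have "\<epsilon> ` (F - G) \<subseteq> B \<times> B" "\<epsilon> ` G \<subseteq> B \<times> B" using assms ends by blast+
  ultimately have "ncl B (eqcl B (\<epsilon> ` G)) \<le> ncl B (eqcl B (\<epsilon> ` F)) + card (F - G)"
    "card B \<le> ncl B (eqcl B (\<epsilon> ` G)) + card G"
    using ncl_rank_step[OF finB, of "F - G" \<epsilon> G] ncl_rank_step[OF finB, of G \<epsilon> "{}"] fin assms(2)
    by (auto simp: Un_absorb1 eqcl_empty ncl_Id_on[OF finB])
  moreover have "card F = card G + card (F - G)"
    using fin assms(2) by (simp add: card_Diff_subset card_mono)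
  ultimately show ?thesis using assms(1) unfolding indep_def by linarith
qed

lemma refine_subset: "refine F n \<subseteq> B \<times> B"
proof (cases n)
  case (Suc m)
  have "refine F n \<subseteq> eqcl B (\<epsilon> ` F 0 \<inter> refine F m)" using p Suc by auto
  then show ?thesis using eqcl_subset_times by blast
qed simp

lemma equiv_refine: "equiv B (refine F n)"
proof (cases n)
  case (Suc m)
  have e: "equiv B (eqcl B (\<epsilon> ` F j \<inter> refine F m))" for j by (rule equiv_eqcl)
  show ?thesis
  proof (rule equivI)
    show "refine F n \<subseteq> B \<times> B" by (rule refine_subset)
    show "refl_on B (refine F n)"
      using equiv_reflD[OF e] Suc by (auto simp: refl_on_def)
    show "sym (refine F n)"
      using equiv_symD[OF e] Suc by (auto simp: sym_def)
    show "trans (refine F n)"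
      unfolding trans_def Suc by (auto intro: equiv_transD[OF e])
  qed
qed (simp add: equiv_times)

lemma refine_Suc_subset: "refine F (Suc n) \<subseteq> refine F n"
proof (induction n)
  case 0
  show ?case using refine_subset[of F "Suc 0"] by simp
next
  case (Suc n)
  have "eqcl B (\<epsilon> ` F j \<inter> refine F (Suc n)) \<subseteq> eqcl B (\<epsilon> ` F j \<inter> refine F n)" for j
    using Suc.IH by (intro eqcl_mono) blast
  then show ?case unfolding refine.simps by blast
qed

lemma maximal_spans:
  assumes "maximal F" "e \<in> I" "\<And>j. j < p \<Longrightarrow> e \<notin> F j" "i < p"
  shows "\<epsilon> e \<in> eqcl B (\<epsilon> ` F i)"
proof (rule ccontr)
  assume n: "\<epsilon> e \<notin> eqcl B (\<epsilon> ` F i)"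
  let ?G = "F(i := insert e (F i))"
  have v: "valid F" using assms(1) unfolding maximal_def by auto
  then have fin: "finite (F i)" using assms(4) finI finite_subset unfolding valid_def by metis
  obtain a b where ab: "\<epsilon> e = (a, b)" "a \<in> B" "b \<in> B" using ends[OF assms(2)] by auto
  have "indep (insert e (F i))"
    using v assms(3,4) fin ncl_insert_eq[OF finB ab(2,3)] n ab(1)
    unfolding valid_def indep_def by fastforce
  then have "valid ?G"
    using v assms(2-4) unfolding valid_def by auto
  then have "weight ?G \<le> weight F" using assms(1) unfolding maximal_def by blast
  moreover have "weight F < weight ?G"
    unfolding weight_def using assms(3,4) fin by (intro sum_strict_mono_ex1) auto
  ultimately show False by simp
qed

text \<open>Otherwise exchange e for an f that leaves the refinement at an earlier stage: the new family is
  maximal, f is uncovered, and up to that stage the refinement has not grown.\<close>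

lemma uncovered_in_refine:
  "maximal F \<Longrightarrow> e \<in> I \<Longrightarrow> (\<And>j. j < p \<Longrightarrow> e \<notin> F j) \<Longrightarrow> \<epsilon> e \<in> refine F n"
proof (induction n arbitrary: F e rule: less_induct)
  case (less n)
  note mx = less.prems(1) and eI = less.prems(2) and unc = less.prems(3)
  have v: "valid F" using mx unfolding maximal_def by auto
  show ?case
  proof (cases n)
    case 0
    then show ?thesis using ends[OF eI] by simp
  next
    case (Suc n')
    show ?thesis
    proof (rule ccontr)
      assume "\<epsilon> e \<notin> refine F n"
      then obtain i where i: "i < p" "\<epsilon> e \<notin> eqcl B (\<epsilon> ` F i \<inter> refine F n')"
        unfolding Suc by auto
      have FiI: "F i \<subseteq> I" using v i unfolding valid_def by auto
      have sp: "\<epsilon> e \<in> eqcl B (\<epsilon> ` F i)"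
        by (rule maximal_spans[OF mx eI unc i(1)])
      \<comment> \<open>\<open>m'\<close> is the first stage at which what is left of
        \<open>F i\<close> no longer spans \<open>e\<close>. It is positive, because at stage 0 all
        of \<open>F i\<close> is available.\<close>
      define Q where "Q j \<longleftrightarrow> \<epsilon> e \<notin> eqcl B (\<epsilon> ` F i \<inter> refine F j)" for j
      define m' where "m' = (LEAST j. Q j)"
      have Qm: "Q m'" unfolding m'_def by (rule LeastI[of Q n']) (use i Q_def in auto)
      have m'le: "m' \<le> n'" unfolding m'_def by (rule Least_le) (use i Q_def in auto)
      have "\<epsilon> ` F i \<inter> refine F 0 = \<epsilon> ` F i" using FiI ends unfolding refine.simps by blast
      then have "\<not> Q 0" using sp unfolding Q_def by simp
      then obtain m where m: "m' = Suc m" using Qm by (cases m') auto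
      have notQ: "\<not> Q j" if "j \<le> m" for j
        using not_less_Least[of j Q] that m unfolding m'_def by auto
      define T where "T = {f \<in> F i. \<epsilon> f \<in> refine F m}"
      have Tim: "\<epsilon> ` T = \<epsilon> ` F i \<inter> refine F m" unfolding T_def by auto
      have finT: "finite T" using FiI finI finite_subset unfolding T_def by fastforce
      \<comment> \<open>A minimal spanning \<open>C\<close> plays the part of the path in the forest
        \<open>F i\<close> between the ends of \<open>e\<close>: each of its members can be
        exchanged for \<open>e\<close>. Some member leaves the refinement at stage
        \<open>Suc m\<close>, since otherwise \<open>e\<close> would still be spanned there.\<close>
      define P where "P C \<longleftrightarrow> C \<subseteq> T \<and> \<epsilon> e \<in> eqcl B (\<epsilon> ` C)" for C
      have "P T" using notQ[of m] Tim unfolding P_def Q_def by auto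
      then obtain C where C: "P C" and Cmin: "\<And>D. P D \<Longrightarrow> card C \<le> card D"
        using ex_has_least_nat[of P T card] by blast
      obtain f where f: "f \<in> C" "\<epsilon> f \<notin> refine F (Suc m)"
      proof (rule ccontr)
        assume "\<not> thesis"
        then have "\<epsilon> ` C \<subseteq> \<epsilon> ` F i \<inter> refine F (Suc m)"
          using that C unfolding P_def T_def by blast
        from eqcl_mono[OF this] show False using C Qm m unfolding P_def Q_def by blast
      qed
      have fFi: "f \<in> F i" and fI: "f \<in> I" using f C FiI unfolding P_def T_def by auto
      have ef: "e \<noteq> f" using fFi unc[OF i(1)] by auto
      have finC: "finite C" using C finT finite_subset unfolding P_def by auto
      have nC: "\<epsilon> e \<notin> eqcl B (\<epsilon> ` (C - {f}))"
      proof
        assume "\<epsilon> e \<in> eqcl B (\<epsilon> ` (C - {f}))"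
        then have "P (C - {f})" using C unfolding P_def by auto
        from Cmin[OF this] show False using f(1) finC by (meson card_Diff1_less leD)
      qed
      obtain a b where ab: "\<epsilon> e = (a, b)" "a \<in> B" "b \<in> B" using ends[OF eI] by auto
      obtain c d where cd: "\<epsilon> f = (c, d)" "c \<in> B" "d \<in> B" using ends[OF fI] by auto
      have "\<epsilon> ` C = insert (c, d) (\<epsilon> ` (C - {f}))" using f(1) cd(1) by (metis image_insert insert_Diff)
      then have "(c, d) \<in> eqcl B (insert (a, b) (\<epsilon> ` (C - {f})))"
        using eqcl_exchange[OF ab(2,3) cd(2,3)] nC C ab(1) unfolding P_def by simp
      moreover have "insert (a, b) (\<epsilon> ` (C - {f})) \<subseteq> \<epsilon> ` insert e (F i - {f})"
        using C ab(1) unfolding P_def T_def by auto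
      ultimately have fin': "(c, d) \<in> eqcl B (\<epsilon> ` insert e (F i - {f}))"
        using eqcl_mono by blast
      define F' where "F' = F(i := insert e (F i - {f}))"
      have "insert (c, d) (\<epsilon> ` insert e (F i - {f})) = insert (a, b) (\<epsilon> ` F i)"
        unfolding ab(1)[symmetric] cd(1)[symmetric] using fFi by blast
      then have cleq: "eqcl B (\<epsilon> ` insert e (F i - {f})) = eqcl B (\<epsilon> ` F i)"
        using eqcl_insert_absorb[OF cd(2,3) fin'] eqcl_insert_absorb[OF ab(2,3)] sp ab(1) by metis
      have finFi: "finite (F i)" using FiI finI finite_subset by auto
      have ceq: "card (insert e (F i - {f})) = card (F i)"
        using finFi fFi unc[OF i(1)] card_Suc_Diff1[OF finFi fFi] by simp
      have disj: "x \<notin> F k" if "x \<in> F j" "j < p" "k < p" "j \<noteq> k" for x j k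
        using v that unfolding valid_def by blast
      have v': "valid F'"
        unfolding valid_def
      proof (intro conjI allI impI)
        fix j assume "j < p"
        then show "F' j \<subseteq> I" "indep (F' j)"
          using v eI ceq cleq unfolding valid_def F'_def indep_def by auto
      next
        fix j k assume "j < p" "k < p" "j \<noteq> k"
        then show "F' j \<inter> F' k = {}"
          using disj unc unfolding F'_def by (auto split: if_splits)
      qed
      have "weight F' = weight F"
        unfolding weight_def F'_def using ceq by (intro sum.cong) auto
      then have mx': "maximal F'" using mx v' unfolding maximal_def by simp
      have unc': "f \<notin> F' j" if "j < p" for j
        using disj[OF fFi i(1) that] ef unfolding F'_def by auto
      \<comment> \<open>Up to stage \<open>m\<close> the pair of \<open>e\<close> already lies in
        the closure of the surviving part of \<open>F i\<close>, so putting \<open>e\<close> in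
        place of \<open>f\<close> adds nothing.\<close>
      have sub: "refine F' j \<subseteq> refine F j" if "j \<le> Suc m" for j
        using that
      proof (induction j)
        case 0
        then show ?case by simp
      next
        case (Suc j)
        have "eqcl B (\<epsilon> ` F' k \<inter> refine F' j) \<subseteq> eqcl B (\<epsilon> ` F k \<inter> refine F j)" if "k < p" for k
        proof (cases "k = i")
          case True
          have "\<epsilon> ` F' i \<inter> refine F' j \<subseteq> insert (a, b) (\<epsilon> ` F i \<inter> refine F j)"
          proof -
            have "\<epsilon> ` F' i \<subseteq> insert (a, b) (\<epsilon> ` F i)"
              unfolding F'_def ab(1)[symmetric] by auto
            then show ?thesis using Suc by auto
          qed
          moreover have "(a, b) \<in> eqcl B (\<epsilon> ` F i \<inter> refine F j)"
            using notQ[of j] Suc.prems ab(1) unfolding Q_def by auto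
          ultimately show ?thesis
            using eqcl_mono eqcl_insert_absorb[OF ab(2,3)] True by metis
        next
          case False
          then have "F' k = F k" by (simp add: F'_def)
          then show ?thesis using Suc by (intro eqcl_mono) auto
        qed
        then show ?case by auto
      qed
      have "\<epsilon> f \<in> refine F' (Suc m)"
        by (rule less.IH[OF _ mx' fI unc']) (use m m'le Suc in auto)
      then show False using sub[of "Suc m"] f(2) by auto
    qed
  qed
qed

text \<open>A descending sequence of finite relations has a stable stage \<open>?R\<close>. There
  every forest spans each class of \<open>?R\<close> from inside, and no uncovered element crosses
  \<open>?R\<close>. So all crossing elements lie in forests, and forest \<open>j\<close> has
  exactly \<open>ncl B ?R\<close> minus its number of components of them. The counting condition
  then leaves at most \<open>p\<close> components in total, one per forest.\<close>

theorem packing_exists: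
  obtains F :: "nat \<Rightarrow> 'i set" where "\<And>j. j < p \<Longrightarrow> F j \<subseteq> I"
    "\<And>j k. j < p \<Longrightarrow> k < p \<Longrightarrow> j \<noteq> k \<Longrightarrow> F j \<inter> F k = {}"
    "\<And>j. j < p \<Longrightarrow> eqcl B (\<epsilon> ` F j) = B \<times> B"
proof -
  have "indep {}" unfolding indep_def by (simp add: eqcl_empty ncl_Id_on[OF finB])
  then have v0: "valid (\<lambda>_. {})" unfolding valid_def by auto
  have bound: "weight G \<le> p * card I" if "valid G" for G
  proof -
    have "card (G j) \<le> card I" if "j < p" for j
      using \<open>valid G\<close> that finI by (auto simp: valid_def intro: card_mono)
    then have "weight G \<le> (\<Sum>j<p. card I)" unfolding weight_def by (intro sum_mono) auto
    then show ?thesis by simp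
  qed
  obtain F where mx: "maximal F"
    using ex_has_greatest_nat[of valid "\<lambda>_. {}" weight "Suc (p * card I)", OF v0] bound
    unfolding maximal_def by (metis less_Suc_eq_le)
  then have v: "valid F" unfolding maximal_def by auto
  obtain n where n: "\<And>k. card (refine F n) \<le> card (refine F k)"
    using ex_has_least_nat[of "\<lambda>_. True" 0 "\<lambda>n. card (refine F n)"] by blast
  let ?R = "refine F n"
  have finR: "finite ?R" using refine_subset finB finite_subset by blast
  have Req: "refine F (Suc n) = ?R"
    using card_seteq[OF finR refine_Suc_subset n] .
  have eR: "equiv B ?R" by (rule equiv_refine)
  have clR: "eqcl B (\<epsilon> ` F j \<inter> ?R) = ?R" if "j < p" for j
  proof
    show "eqcl B (\<epsilon> ` F j \<inter> ?R) \<subseteq> ?R" by (rule eqcl_least[OF eR]) auto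
    show "?R \<subseteq> eqcl B (\<epsilon> ` F j \<inter> ?R)" using Req that by auto
  qed
  define X where "X j = {f \<in> F j. \<epsilon> f \<notin> ?R}" for j
  have finF: "finite (F j)" if "j < p" for j
    using that v finI finite_subset unfolding valid_def by metis
  have cX: "card (X j) + ncl B (eqcl B (\<epsilon> ` F j)) = ncl B ?R" if "j < p" for j
  proof -
    let ?S = "{f \<in> F j. \<epsilon> f \<in> ?R}"
    have "indep ?S" using indep_subset[of "F j" ?S] v that unfolding valid_def by auto
    moreover have "\<epsilon> ` ?S = \<epsilon> ` F j \<inter> ?R" by auto
    ultimately have "card ?S + ncl B ?R = card B" unfolding indep_def using clR[OF that] by simp
    moreover have "card (F j) = card ?S + card (X j)"
    proof -
      have "F j = ?S \<union> X j" "?S \<inter> X j = {}" unfolding X_def by auto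
      moreover have "finite ?S" "finite (X j)" using finF[OF that] unfolding X_def by auto
      ultimately show ?thesis by (metis card_Un_disjoint)
    qed
    moreover have "card (F j) + ncl B (eqcl B (\<epsilon> ` F j)) = card B"
      using v that unfolding valid_def indep_def by auto
    ultimately show ?thesis by linarith
  qed
  have "{i \<in> I. \<epsilon> i \<notin> ?R} \<subseteq> (\<Union>j<p. X j)"
    using uncovered_in_refine[OF mx] unfolding X_def by blast
  moreover have finX: "finite (X j)" if "j < p" for j using finF[OF that] unfolding X_def by auto
  ultimately have "card {i \<in> I. \<epsilon> i \<notin> ?R} \<le> card (\<Union>j<p. X j)"
    by (intro card_mono) auto
  also have "\<dots> \<le> (\<Sum>j<p. card (X j))" by (rule card_UN_le) auto
  finally have "p * ncl B ?R \<le> (\<Sum>j<p. card (X j)) + p"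
    using cond[OF eR] by linarith
  moreover have "p * ncl B ?R = (\<Sum>j<p. card (X j)) + (\<Sum>j<p. ncl B (eqcl B (\<epsilon> ` F j)))"
    unfolding sum.distrib[symmetric] using cX by simp
  ultimately have le: "(\<Sum>j<p. ncl B (eqcl B (\<epsilon> ` F j))) \<le> (\<Sum>j<p. 1)" by simp
  have ge: "1 \<le> ncl B (eqcl B (\<epsilon> ` F j))" for j
    by (rule ncl_ge_1[OF finB neB equiv_eqcl])
  have "ncl B (eqcl B (\<epsilon> ` F j)) = 1" if "j < p" for j
  proof (rule ccontr)
    assume "ncl B (eqcl B (\<epsilon> ` F j)) \<noteq> 1"
    then have "1 < ncl B (eqcl B (\<epsilon> ` F j))" using ge[of j] by simp
    then have "(\<Sum>j<p. 1) < (\<Sum>j<p. ncl B (eqcl B (\<epsilon> ` F j)))"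
      using that ge by (intro sum_strict_mono_ex1) auto
    then show False using le by simp
  qed
  then have "eqcl B (\<epsilon> ` F j) = B \<times> B" if "j < p" for j
    using ncl_eq_1D[OF equiv_eqcl] that by blast
  then show ?thesis using that[of F] v unfolding valid_def by blast
qed

end

section \<open>Splitting off pairs of half-edges\<close>

text \<open>A sum of indicators, so that inequalities between cuts can be checked one half-edge at a
  time.\<close>

definition mass :: "('q \<Rightarrow> 'b) \<Rightarrow> 'q set \<Rightarrow> 'b set \<Rightarrow> nat" where
  "mass v S P = (\<Sum>q\<in>S. of_bool (v q \<in> P))"

text \<open>The least number of half-edges of the block S to cut when the vertex that S stands for may lie on either side.\<close>

definition cutval :: "('q \<Rightarrow> 'b) \<Rightarrow> 'q set \<Rightarrow> 'b set \<Rightarrow> nat" where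
  "cutval v S P = min (mass v S P) (mass v S (- P))"

lemma mass_compl: "finite S \<Longrightarrow> mass v S P + mass v S (- P) = card S"
proof -
  have "(\<Sum>q\<in>S. of_bool (v q \<in> P) + of_bool (v q \<in> - P)) = (\<Sum>q\<in>S. 1 :: nat)"
    by (intro sum.cong) auto
  then show ?thesis unfolding mass_def sum.distrib by simp
qed

lemma mass_Diff:
  assumes "v ` S \<subseteq> B"
  shows "mass v S (B - P) = mass v S (- P)"
  unfolding mass_def using assms by (intro sum.cong) auto

lemma mass_card: "finite S \<Longrightarrow> mass v S P = card {q \<in> S. v q \<in> P}"
  unfolding mass_def by (simp add: Int_def)

text \<open>The boolean \<open>b\<close> tells whether the vertex that \<open>S\<close> stands for
  is put on the side of \<open>P\<close>. Together with the next lemma, \<open>cutval\<close> is the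
  minimum over both placements.\<close>

lemma cutval_le: "cutval v S P \<le> (\<Sum>q\<in>S. of_bool ((v q \<in> P) \<noteq> b))"
  unfolding cutval_def mass_def by (cases b) auto

lemma cutval_attained: "\<exists>b. cutval v S P = (\<Sum>q\<in>S. of_bool ((v q \<in> P) \<noteq> b))"
proof (cases "mass v S P \<le> mass v S (- P)")
  case True
  then show ?thesis unfolding cutval_def mass_def by (intro exI[of _ False]) auto
next
  case False
  then show ?thesis unfolding cutval_def mass_def by (intro exI[of _ True]) auto
qed

text \<open>From optimal placements \<open>b\<close> for \<open>X\<close> and \<open>c\<close> for
  \<open>Y\<close>, place the vertex by conjunction for the intersection and by disjunction for the
  union. Then every half-edge satisfies the inequality separately.\<close>

lemma cutval_submodular:
  "cutval v S (X \<inter> Y) + cutval v S (X \<union> Y) \<le> cutval v S X + cutval v S Y"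
proof -
  obtain b c where b: "cutval v S X = (\<Sum>q\<in>S. of_bool ((v q \<in> X) \<noteq> b))"
    and c: "cutval v S Y = (\<Sum>q\<in>S. of_bool ((v q \<in> Y) \<noteq> c))"
    using cutval_attained by metis
  have "cutval v S (X \<inter> Y) + cutval v S (X \<union> Y)
      \<le> (\<Sum>q\<in>S. of_bool ((v q \<in> X \<inter> Y) \<noteq> (b \<and> c)) + of_bool ((v q \<in> X \<union> Y) \<noteq> (b \<or> c)))"
    unfolding sum.distrib by (intro add_mono cutval_le)
  also have "\<dots> \<le> (\<Sum>q\<in>S. of_bool ((v q \<in> X) \<noteq> b) + of_bool ((v q \<in> Y) \<noteq> c))"
    by (intro sum_mono) (auto simp: of_bool_def)
  finally show ?thesis unfolding b c sum.distrib .
qed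

text \<open>The three-set inequality for cuts in graphs. The placements for the four sets on the
  left are the boolean combinations that define these sets.\<close>

lemma cutval_three:
  "cutval v S (X \<inter> Y \<inter> Z) + cutval v S (X - Y - Z) + cutval v S (Y - X - Z) + cutval v S (Z - X - Y)
    \<le> cutval v S X + cutval v S Y + cutval v S Z"
proof -
  obtain b c d where b: "cutval v S X = (\<Sum>q\<in>S. of_bool ((v q \<in> X) \<noteq> b))"
    and c: "cutval v S Y = (\<Sum>q\<in>S. of_bool ((v q \<in> Y) \<noteq> c))"
    and d: "cutval v S Z = (\<Sum>q\<in>S. of_bool ((v q \<in> Z) \<noteq> d))"
    using cutval_attained by metis
  have "cutval v S (X \<inter> Y \<inter> Z) + cutval v S (X - Y - Z) + cutval v S (Y - X - Z) + cutval v S (Z - X - Y)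
      \<le> (\<Sum>q\<in>S. of_bool ((v q \<in> X \<inter> Y \<inter> Z) \<noteq> (b \<and> c \<and> d)) + of_bool ((v q \<in> X - Y - Z) \<noteq> (b \<and> \<not> c \<and> \<not> d))
          + of_bool ((v q \<in> Y - X - Z) \<noteq> (c \<and> \<not> b \<and> \<not> d)) + of_bool ((v q \<in> Z - X - Y) \<noteq> (d \<and> \<not> b \<and> \<not> c)))"
    unfolding sum.distrib by (intro add_mono cutval_le)
  also have "\<dots> \<le> (\<Sum>q\<in>S. of_bool ((v q \<in> X) \<noteq> b) + of_bool ((v q \<in> Y) \<noteq> c) + of_bool ((v q \<in> Z) \<noteq> d))"
  proof (rule sum_mono)
    fix q
    show "of_bool ((v q \<in> X \<inter> Y \<inter> Z) \<noteq> (b \<and> c \<and> d)) + of_bool ((v q \<in> X - Y - Z) \<noteq> (b \<and> \<not> c \<and> \<not> d))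
          + of_bool ((v q \<in> Y - X - Z) \<noteq> (c \<and> \<not> b \<and> \<not> d)) + of_bool ((v q \<in> Z - X - Y) \<noteq> (d \<and> \<not> b \<and> \<not> c))
        \<le> (of_bool ((v q \<in> X) \<noteq> b) + of_bool ((v q \<in> Y) \<noteq> c) + of_bool ((v q \<in> Z) \<noteq> d) :: nat)"
      by (cases b; cases c; cases d; cases "v q \<in> X"; cases "v q \<in> Y"; cases "v q \<in> Z") simp_all
  qed
  finally show ?thesis unfolding b c d sum.distrib .
qed

lemma cutval_Diff:
  assumes "v ` S \<subseteq> B"
  shows "cutval v S (B - P) = cutval v S P"
proof -
  have "mass v S (- (B - P)) = mass v S P"
    unfolding mass_def using assms by (intro sum.cong) auto
  then show ?thesis unfolding cutval_def mass_Diff[OF assms] by (simp add: min.commute)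
qed

lemma mass_modular: "mass v S (X \<inter> Y) + mass v S (X \<union> Y) = mass v S X + mass v S Y"
  unfolding mass_def sum.distrib[symmetric] by (intro sum.cong) auto

lemma mass_three:
  "3 * mass v S (X \<inter> Y \<inter> Z) + mass v S (X - Y - Z) + mass v S (Y - X - Z) + mass v S (Z - X - Y)
    \<le> mass v S X + mass v S Y + mass v S Z"
  unfolding mass_def sum_distrib_left sum.distrib[symmetric] by (intro sum_mono) auto

lemma mass_pos: "finite S \<Longrightarrow> q \<in> S \<Longrightarrow> v q \<in> P \<Longrightarrow> mass v S P \<ge> 1"
  unfolding mass_card by (auto simp: Suc_le_eq card_gt_0_iff)

text \<open>One block is singled out, and all others enter through their total cut \<open>d\<close>.
  The bound \<open>low\<close> is the cut with the vertex of \<open>S\<close> placed outside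
  \<open>P\<close>; applied to the complement it gives the other placement.\<close>

locale block_split =
  fixes B :: "'b set" and S :: "'q set" and v :: "'q \<Rightarrow> 'b" and d :: "'b set \<Rightarrow> nat" and K :: nat
  assumes finB: "finite B" and finS: "finite S" and SB: "v ` S \<subseteq> B" and S4: "card S \<ge> 4" and K2: "K \<ge> 2"
    and dsym: "\<And>P. d (B - P) = d P"
    and dsub: "\<And>X Y. d (X \<inter> Y) + d (X \<union> Y) \<le> d X + d Y"
    and dthree: "\<And>X Y Z. d (X \<inter> Y \<inter> Z) + d (X - Y - Z) + d (Y - X - Z) + d (Z - X - Y) \<le> d X + d Y + d Z"
    and low: "\<And>P. P \<noteq> {} \<Longrightarrow> P \<subset> B \<Longrightarrow> K \<le> d P + mass v S P"
begin

abbreviation m :: "'b set \<Rightarrow> nat" where "m \<equiv> mass v S"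

text \<open>Splitting off two half-edges is harmful exactly if both lie in a dangerous set.\<close>

definition dangerous :: "'b set \<Rightarrow> bool" where
  "dangerous P \<longleftrightarrow> P \<subset> B \<and> d P + m P \<le> K + 1"

lemma m_Diff: "m P + m (B - P) = card S"
  using mass_compl[OF finS, of v P] mass_Diff[OF SB, of P] by simp

lemma low_compl: "P \<noteq> {} \<Longrightarrow> P \<subset> B \<Longrightarrow> K + m P \<le> d P + card S"
proof -
  assume "P \<noteq> {}" "P \<subset> B"
  then have "B - P \<noteq> {}" "B - P \<subset> B" by blast+
  then show ?thesis using low[of "B - P"] dsym[of P] m_Diff[of P] by linarith
qed

text \<open>With the vertex of \<open>S\<close> on the side of \<open>P\<close> the cut is
  \<open>d P + card S - m P\<close>, which would drop below \<open>K\<close> if \<open>P\<close>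
  held more half-edges.\<close>

lemma dangerous_m_le: "dangerous P \<Longrightarrow> P \<noteq> {} \<Longrightarrow> 2 * m P \<le> card S + 1"
  using low_compl[of P] unfolding dangerous_def by auto

text \<open>Applying \<open>low\<close> to the four sets of \<open>dthree\<close> gives 4K + 2 at
  most 3K + 3. The 2 is the surplus with which \<open>mass_three\<close> counts \<open>q0\<close>,
  and K is at least 2.\<close>

lemma three_dangerous:
  assumes "dangerous X" "dangerous Y" "dangerous Z" "q0 \<in> S" "v q0 \<in> X \<inter> Y \<inter> Z"
    and ne: "X - Y - Z \<noteq> {}" "Y - X - Z \<noteq> {}" "Z - X - Y \<noteq> {}"
  shows False
proof -
  have "X \<subset> B" "Y \<subset> B" "Z \<subset> B" using assms unfolding dangerous_def by auto
  then have "K \<le> d (X \<inter> Y \<inter> Z) + m (X \<inter> Y \<inter> Z)" "K \<le> d (X - Y - Z) + m (X - Y - Z)"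
    "K \<le> d (Y - X - Z) + m (Y - X - Z)" "K \<le> d (Z - X - Y) + m (Z - X - Y)"
    using assms(5) ne by (intro low; blast)+
  moreover have "m (X \<inter> Y \<inter> Z) \<ge> 1" by (rule mass_pos[where v = v, OF finS assms(4,5)])
  ultimately show False
    using dthree[of X Y Z] mass_three[of v S X Y Z] assms(1-3) K2 unfolding dangerous_def by linarith
qed

text \<open>In a cover with the fewest dangerous sets each member has a private half-edge, so three
  members would satisfy the hypotheses of \<open>three_dangerous\<close>.\<close>

lemma cover_by_two:
  assumes q0: "q0 \<in> S"
    and bad: "\<And>q. q \<in> S \<Longrightarrow> q \<noteq> q0 \<Longrightarrow> \<exists>P. dangerous P \<and> v q0 \<in> P \<and> v q \<in> P"
  obtains X Y where "dangerous X" "dangerous Y" "v q0 \<in> X \<inter> Y" "v ` S \<subseteq> X \<union> Y"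
proof -
  define Ok where "Ok \<C> \<longleftrightarrow> (\<forall>P\<in>\<C>. dangerous P \<and> v q0 \<in> P) \<and> v ` S \<subseteq> \<Union>\<C>" for \<C>
  obtain q1 where "q1 \<in> S" "q1 \<noteq> q0"
    using S4 card_mono[of "{q0}" S] by fastforce
  then have "Ok {P. dangerous P \<and> v q0 \<in> P}"
    unfolding Ok_def using bad by blast
  then obtain \<C> where C: "Ok \<C>" and min: "\<And>\<D>. Ok \<D> \<Longrightarrow> card \<C> \<le> card \<D>"
    using ex_has_least_nat[of Ok _ card] by blast
  have "\<C> \<subseteq> Pow B" using C unfolding Ok_def dangerous_def by auto
  then have finC: "finite \<C>" using finB finite_subset by blast
  have priv: "\<exists>q\<in>S. v q \<in> X \<and> (\<forall>Y\<in>\<C> - {X}. v q \<notin> Y)" if "X \<in> \<C>" for X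
  proof (rule ccontr)
    assume "\<not> ?thesis"
    then have "Ok (\<C> - {X})" using C unfolding Ok_def by (auto; blast)
    from min[OF this] show False using that finC by (meson card_Diff1_less leD)
  qed
  have "card \<C> \<le> 2"
  proof (rule ccontr)
    assume "\<not> ?thesis"
    then have "3 \<le> card \<C>" by simp
    from obtain_subset_with_card_n[OF this]
    obtain T where T: "T \<subseteq> \<C>" "card T = 3" by metis
    obtain X Y Z where "T = {X, Y, Z}" "X \<noteq> Y" "X \<noteq> Z" "Y \<noteq> Z" using T(2) by (auto simp: card_3_iff)
    then have XYZ: "X \<in> \<C>" "Y \<in> \<C>" "Z \<in> \<C>" "X \<noteq> Y" "X \<noteq> Z" "Y \<noteq> Z" using T by auto
    have "X - Y - Z \<noteq> {}" using priv[OF XYZ(1)] XYZ by blast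
    moreover have "Y - X - Z \<noteq> {}" using priv[OF XYZ(2)] XYZ by blast
    moreover have "Z - X - Y \<noteq> {}" using priv[OF XYZ(3)] XYZ by blast
    ultimately show False
      using three_dangerous[of X Y Z q0] XYZ C q0 unfolding Ok_def by blast
  qed
  moreover have "\<C> \<noteq> {}" using C q0 unfolding Ok_def by auto
  ultimately have "card \<C> = 1 \<or> card \<C> = 2" using finC by (metis card_0_eq le_Suc_eq le_zero_eq numeral_2_eq_2 One_nat_def)
  then obtain X Y where "\<C> = {X, Y}" by (auto simp: card_1_singleton_iff card_2_iff)
  then show ?thesis using that[of X Y] C unfolding Ok_def by auto
qed

text \<open>Two dangerous sets X and Y cover all of B, so their complements \<open>A1\<close> and \<open>A2\<close> are tight and each contains half
  of the other half-edges.\<close>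

lemma bad_half_edge:
  assumes q0: "q0 \<in> S"
    and bad: "\<And>q. q \<in> S \<Longrightarrow> q \<noteq> q0 \<Longrightarrow> \<exists>P. dangerous P \<and> v q0 \<in> P \<and> v q \<in> P"
  obtains A1 A2 where "A1 \<subseteq> B" "A2 \<subseteq> B" "v q0 \<notin> A1" "v q0 \<notin> A2"
    "\<And>q. q \<in> S \<Longrightarrow> q \<noteq> q0 \<Longrightarrow> v q \<in> A1 \<or> v q \<in> A2"
    "d A1 + m A1 \<le> K" "d A2 + m A2 \<le> K" "2 * m A1 + 1 = card S" "2 * m A2 + 1 = card S"
proof -
  obtain X Y where XY: "dangerous X" "dangerous Y" "v q0 \<in> X \<inter> Y" "v ` S \<subseteq> X \<union> Y"
    using cover_by_two[OF q0 bad] by blast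
  have mX: "2 * m X \<le> card S + 1" and mY: "2 * m Y \<le> card S + 1"
    using dangerous_m_le XY by auto
  have mU: "m (X \<union> Y) = card S"
    unfolding mass_card[OF finS] using XY(4) by (intro arg_cong[of _ _ card]) auto
  have mI: "m (X \<inter> Y) \<ge> 1" by (rule mass_pos[where v = v, OF finS q0 XY(3)])
  \<comment> \<open>Each set holds at most half of \<open>card S + 1\<close>, while together they
    hold everything and share \<open>q0\<close>. All these bounds are therefore equalities, and
    \<open>card S\<close> is odd.\<close>
  have eq: "2 * m X = card S + 1" "2 * m Y = card S + 1" "m (X \<inter> Y) = 1"
    using mass_modular[of v S X Y] mX mY mU mI by linarith+
  have "X \<subset> B" "Y \<subset> B" using XY unfolding dangerous_def by auto
  \<comment> \<open>Otherwise uncrossing yields 2K - 1 at most 2K + 1 - \<open>card S\<close>,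
    against \<open>card S\<close> being at least 4.\<close>
  have U: "X \<union> Y = B"
  proof (rule ccontr)
    assume "X \<union> Y \<noteq> B"
    then have pr: "X \<union> Y \<subset> B" "X \<inter> Y \<subset> B" using \<open>X \<subset> B\<close> \<open>Y \<subset> B\<close> by auto
    then have "K + m (X \<union> Y) \<le> d (X \<union> Y) + card S" "K \<le> d (X \<inter> Y) + m (X \<inter> Y)"
      using XY(3) low_compl[of "X \<union> Y"] low[of "X \<inter> Y"] by blast+
    then show False
      using dsub[of X Y] XY(1,2) eq mU S4 unfolding dangerous_def by linarith
  qed
  show ?thesis
  proof (rule that[of "B - X" "B - Y"])
    show "v q \<in> B - X \<or> v q \<in> B - Y" if "q \<in> S" "q \<noteq> q0" for q
    proof (rule ccontr)
      assume "\<not> ?thesis"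
      then have "{q, q0} \<subseteq> {q \<in> S. v q \<in> X \<inter> Y}" using that SB XY(3) q0 by auto
      from card_mono[OF _ this] show False
        using eq(3) that finS unfolding mass_card[OF finS] by simp
    qed
    show "d (B - X) + m (B - X) \<le> K" "d (B - Y) + m (B - Y) \<le> K"
      using dsym[of X] dsym[of Y] m_Diff[of X] m_Diff[of Y] XY(1,2) eq unfolding dangerous_def by linarith+
    show "2 * m (B - X) + 1 = card S" "2 * m (B - Y) + 1 = card S"
      using m_Diff[of X] m_Diff[of Y] eq by linarith+
  qed (use XY(3) in auto)
qed

text \<open>If \<open>q0\<close> is bad, take \<open>q1\<close> in the resulting tight set A. If \<open>q1\<close> is bad too, some tight set C meets A but misses \<open>q1\<close>,
  and the union of A and C is tight and too large.\<close>

theorem splittable_pair: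
  "\<exists>q1\<in>S. \<exists>q2\<in>S. q1 \<noteq> q2 \<and>
    (\<forall>P. P \<subset> B \<longrightarrow> v q1 \<in> P \<longrightarrow> v q2 \<in> P \<longrightarrow> K + 2 \<le> d P + m P)"
proof (rule ccontr)
  assume neg: "\<not> ?thesis"
  have bad: "\<exists>P. dangerous P \<and> v q1 \<in> P \<and> v q2 \<in> P" if "q1 \<in> S" "q2 \<in> S" "q2 \<noteq> q1" for q1 q2
  proof (rule ccontr)
    assume "\<not> ?thesis"
    then have "K + 2 \<le> d P + m P" if "P \<subset> B" "v q1 \<in> P" "v q2 \<in> P" for P
      using that unfolding dangerous_def by force
    then show False using neg that by blast
  qed
  obtain q0 where q0: "q0 \<in> S" using S4 by fastforce
  obtain A where A: "A \<subseteq> B" "v q0 \<notin> A" "d A + m A \<le> K" "2 * m A + 1 = card S"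
    using bad_half_edge[OF q0 bad[OF q0]] by metis
  \<comment> \<open>\<open>card S\<close> is odd and at least 4, so it is at least 5 and
    \<open>A\<close> holds two half-edges.\<close>
  have "2 \<le> card {q \<in> S. v q \<in> A}" using A(4) S4 unfolding mass_card[OF finS, of v A] by linarith
  from obtain_subset_with_card_n[OF this]
  obtain T where T: "T \<subseteq> {q \<in> S. v q \<in> A}" "card T = 2" by metis
  obtain q1 q2 where "T = {q1, q2}" "q1 \<noteq> q2" using T(2) by (auto simp: card_2_iff)
  then have q12: "q1 \<in> S" "q2 \<in> S" "v q1 \<in> A" "v q2 \<in> A" "q2 \<noteq> q1" using T by auto
  obtain C where C: "C \<subseteq> B" "v q1 \<notin> C" "v q2 \<in> C" "d C + m C \<le> K" "2 * m C + 1 = card S"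
    using bad_half_edge[OF q12(1) bad[OF q12(1)]] q12 by metis
  have "m (A \<inter> C) \<ge> 1" using mass_pos[OF finS q12(2), of v "A \<inter> C"] q12 C by auto
  then have mU: "m (A \<union> C) < card S" using mass_modular[of v S A C] A C by linarith
  have "m B = card S" using m_Diff[of "{}"] by (simp add: mass_def)
  then have pr: "A \<union> C \<subset> B" using mU A(1) C(1) by (metis Un_least less_irrefl psubsetI)
  then have "K + m (A \<union> C) \<le> d (A \<union> C) + card S"
    using low_compl[of "A \<union> C"] C(3) by blast
  moreover have "A \<inter> C \<subset> B" using pr by blast
  then have "K \<le> d (A \<inter> C) + m (A \<inter> C)" using low[of "A \<inter> C"] C(3) q12 by blast
  ultimately have "2 * m (A \<union> C) \<le> card S"
    using dsub[of A C] mass_modular[of v S A C] A C by linarith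
  moreover have "m (A \<union> C) \<ge> m C + 1"
  proof -
    have "insert q1 {q \<in> S. v q \<in> C} \<subseteq> {q \<in> S. v q \<in> A \<union> C}" using q12 by auto
    from card_mono[OF _ this] show ?thesis
      using finS C(2) unfolding mass_card[OF finS] by simp
  qed
  ultimately show False using C(5) by linarith
qed

end

section \<open>Repeated splitting, and from cuts to partition connectivity\<close>

definition cut_bounded :: "'b set \<Rightarrow> ('q \<Rightarrow> 'b) \<Rightarrow> nat \<Rightarrow> 'q set set \<Rightarrow> bool" where
  "cut_bounded B v K \<S> \<longleftrightarrow> (\<forall>P. P \<noteq> {} \<longrightarrow> P \<subset> B \<longrightarrow> K \<le> (\<Sum>S\<in>\<S>. cutval v S P))"

lemma mass_pair: "q1 \<noteq> q2 \<Longrightarrow> mass v {q1, q2} P = of_bool (v q1 \<in> P) + of_bool (v q2 \<in> P)"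
  unfolding mass_def by simp

lemma mass_remove_pair:
  assumes "finite S" "q1 \<in> S" "q2 \<in> S" "q1 \<noteq> q2"
  shows "mass v S P = of_bool (v q1 \<in> P) + of_bool (v q2 \<in> P) + mass v (S - {q1, q2}) P"
proof -
  have "S - {q1, q2} = S - {q1} - {q2}" by auto
  then show ?thesis
    using assms sum.remove[of S q1 "\<lambda>q. of_bool (v q \<in> P) :: nat"]
      sum.remove[of "S - {q1}" q2 "\<lambda>q. of_bool (v q \<in> P) :: nat"]
    unfolding mass_def by simp
qed

text \<open>If \<open>P\<close> separates the far ends of \<open>q1\<close> and \<open>q2\<close>,
  the pair is cut once under either placement, before and after. If not, the new pair costs nothing,
  and the surplus 2 from \<open>splittable_pair\<close> makes up for the lost half-edges.\<close>

lemma split_block: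
  assumes finB: "finite B" and finC: "finite \<C>" and S: "S \<in> \<C>" and K: "K \<ge> 2"
    and blocks: "\<And>T. T \<in> \<C> \<Longrightarrow> finite T \<and> v ` T \<subseteq> B"
    and S4: "card S \<ge> 4" and cb: "cut_bounded B v K \<C>"
  obtains q1 q2 where "q1 \<in> S" "q2 \<in> S" "q1 \<noteq> q2"
    "\<And>P. P \<noteq> {} \<Longrightarrow> P \<subset> B \<Longrightarrow>
       K \<le> cutval v {q1, q2} P + cutval v (S - {q1, q2}) P + (\<Sum>T\<in>\<C> - {S}. cutval v T P)"
proof -
  define d where "d P = (\<Sum>T\<in>\<C> - {S}. cutval v T P)" for P
  have total: "K \<le> cutval v S P + d P" if "P \<noteq> {}" "P \<subset> B" for P
    using cb that sum.remove[OF finC S, of "\<lambda>T. cutval v T P"] unfolding cut_bounded_def d_def by metis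
  have finS: "finite S" and SB: "v ` S \<subseteq> B" using blocks[OF S] by auto
  have dsym: "d (B - P) = d P" for P
    unfolding d_def using blocks by (intro sum.cong) (auto intro!: cutval_Diff)
  interpret block_split B S v d K
  proof
    show "d (X \<inter> Y) + d (X \<union> Y) \<le> d X + d Y" for X Y
      unfolding d_def sum.distrib[symmetric] by (intro sum_mono cutval_submodular)
    show "d (X \<inter> Y \<inter> Z) + d (X - Y - Z) + d (Y - X - Z) + d (Z - X - Y) \<le> d X + d Y + d Z" for X Y Z
      unfolding d_def sum.distrib[symmetric] by (intro sum_mono cutval_three)
    show "K \<le> d P + mass v S P" if "P \<noteq> {}" "P \<subset> B" for P
      using total[OF that] unfolding cutval_def by linarith
  qed (use finB finS SB S4 K dsym in auto)
  obtain q1 q2 where q: "q1 \<in> S" "q2 \<in> S" "q1 \<noteq> q2"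
    and safe: "\<And>P. P \<subset> B \<Longrightarrow> v q1 \<in> P \<Longrightarrow> v q2 \<in> P \<Longrightarrow> K + 2 \<le> d P + mass v S P"
    using splittable_pair by blast
  show ?thesis
  proof (rule that[OF q])
    fix P assume P: "P \<noteq> {}" "P \<subset> B"
    let ?S' = "S - {q1, q2}"
    have q1B: "v q1 \<in> B" "v q2 \<in> B" using SB q by auto
    have dec: "mass v S X = of_bool (v q1 \<in> X) + of_bool (v q2 \<in> X) + mass v ?S' X" for X
      by (rule mass_remove_pair[OF finS q])
    note pair = mass_pair[OF q(3), of v]
    have t: "K \<le> min (mass v S P) (mass v S (- P)) + d P"
      using total[OF P] unfolding cutval_def .
    have "K \<le> cutval v {q1, q2} P + cutval v ?S' P + d P"
    proof (cases "v q1 \<in> P"; cases "v q2 \<in> P")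
      assume a: "v q1 \<in> P" "v q2 \<in> P"
      then have "K + 2 \<le> d P + mass v S P" using safe P by blast
      then show ?thesis using t a dec[of P] dec[of "- P"] unfolding cutval_def by simp
    next
      assume a: "v q1 \<notin> P" "v q2 \<notin> P"
      have "B - P \<subset> B" using P by blast
      then have "K + 2 \<le> d (B - P) + mass v S (B - P)" using safe[of "B - P"] a q1B by blast
      then have "K + 2 \<le> d P + mass v S (- P)" using dsym mass_Diff[OF SB] by simp
      then show ?thesis using t a dec[of P] dec[of "- P"] unfolding cutval_def by simp
    next
      assume a: "v q1 \<in> P" "v q2 \<notin> P"
      then show ?thesis using t dec[of P] dec[of "- P"] pair unfolding cutval_def by simp
    next
      assume a: "v q1 \<notin> P" "v q2 \<in> P"
      then show ?thesis using t dec[of P] dec[of "- P"] pair unfolding cutval_def by simp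
    qed
    then show "K \<le> cutval v {q1, q2} P + cutval v ?S' P + (\<Sum>T\<in>\<C> - {S}. cutval v T P)"
      unfolding d_def .
  qed
qed

text \<open>In an admissible family with the most blocks none has four half-edges, since splitting
  it would add a block. Recording that only blocks of size at least four are broken up will keep the
  two halves of an edge between big vertices together.\<close>

theorem splitting:
  assumes finB: "finite B" and finC: "finite \<C>" and K: "K \<ge> 2"
    and blocks: "\<And>T. T \<in> \<C> \<Longrightarrow> finite T \<and> v ` T \<subseteq> B \<and> T \<noteq> {}"
    and disj: "pairwise disjnt \<C>" and cb: "cut_bounded B v K \<C>"
  obtains \<S> where "pairwise disjnt \<S>" "\<And>S. S \<in> \<S> \<Longrightarrow> S \<noteq> {} \<and> card S \<le> 3"
    "\<And>S. S \<in> \<S> \<Longrightarrow> S \<in> \<C> \<or> (\<exists>T\<in>\<C>. 4 \<le> card T \<and> S \<subseteq> T)" "cut_bounded B v K \<S>"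
proof -
  define Ok where "Ok \<S> \<longleftrightarrow> pairwise disjnt \<S> \<and> {} \<notin> \<S> \<and>
      (\<forall>S\<in>\<S>. S \<in> \<C> \<or> (\<exists>T\<in>\<C>. 4 \<le> card T \<and> S \<subseteq> T)) \<and> cut_bounded B v K \<S>" for \<S>
  let ?U = "Pow (\<Union>\<C>)"
  have finU: "finite ?U" using finC blocks by auto
  have sub: "\<S> \<subseteq> ?U" if "Ok \<S>" for \<S> using that unfolding Ok_def by blast
  have "Ok \<C>" using blocks disj cb unfolding Ok_def by auto
  moreover have "\<forall>\<S>. Ok \<S> \<longrightarrow> card \<S> < Suc (card ?U)"
    using card_mono[OF finU sub] by (simp add: less_Suc_eq_le)
  ultimately obtain \<S> where ok: "Ok \<S>" and max: "\<And>\<T>. Ok \<T> \<Longrightarrow> card \<T> \<le> card \<S>"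
    using ex_has_greatest_nat[of Ok \<C> card "Suc (card ?U)"] by blast
  have finS: "finite \<S>" using sub[OF ok] finU finite_subset by blast
  have Sblocks: "finite T \<and> v ` T \<subseteq> B" if "T \<in> \<S>" for T
  proof -
    have "T \<in> \<C> \<or> (\<exists>T'\<in>\<C>. 4 \<le> card T' \<and> T \<subseteq> T')" using ok that unfolding Ok_def by simp
    then obtain T' where "T' \<in> \<C>" "T \<subseteq> T'" by auto
    then show ?thesis using blocks[of T'] finite_subset[of T T'] by blast
  qed
  have "card S \<le> 3" if S: "S \<in> \<S>" for S
  proof (rule ccontr)
    assume "\<not> card S \<le> 3"
    then have S4: "card S \<ge> 4" by simp
    have "cut_bounded B v K \<S>" using ok unfolding Ok_def by auto
    then obtain q1 q2 where q: "q1 \<in> S" "q2 \<in> S" "q1 \<noteq> q2"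
      and cut: "\<And>P. P \<noteq> {} \<Longrightarrow> P \<subset> B \<Longrightarrow>
       K \<le> cutval v {q1, q2} P + cutval v (S - {q1, q2}) P + (\<Sum>T\<in>\<S> - {S}. cutval v T P)"
      using split_block[OF finB finS S K Sblocks S4] by blast
    let ?A = "{q1, q2}" and ?D = "S - {q1, q2}"
    have dis: "disjnt T S" if "T \<in> \<S> - {S}" for T
      using ok S that unfolding Ok_def pairwise_def by blast
    have ne: "?D \<noteq> {}"
    proof
      assume "?D = {}"
      then have "S \<subseteq> {q1, q2}" by auto
      from card_mono[OF _ this] show False using S4 by (auto simp: card_insert_if split: if_splits)
    qed
    have nin: "?A \<notin> \<S> - {S}" "?D \<notin> \<S> - {S}" "?A \<noteq> ?D"
      using dis q ne by (auto simp: disjnt_def)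
    let ?T = "insert ?A (insert ?D (\<S> - {S}))"
    have "pairwise disjnt (\<S> - {S})" using ok unfolding Ok_def by (meson Diff_subset pairwise_subset)
    then have "pairwise disjnt ?T"
      using dis q unfolding pairwise_insert by (auto simp: disjnt_def)
    moreover have "{} \<notin> ?T" using ok ne unfolding Ok_def by auto
    moreover have "\<forall>R\<in>?T. R \<in> \<C> \<or> (\<exists>T\<in>\<C>. 4 \<le> card T \<and> R \<subseteq> T)"
    proof -
      obtain T where T: "T \<in> \<C>" "4 \<le> card T" "S \<subseteq> T"
        using ok S S4 unfolding Ok_def by blast
      then have "?A \<subseteq> T" "?D \<subseteq> T" using q by auto
      then show ?thesis using T ok unfolding Ok_def by blast
    qed
    moreover have "cut_bounded B v K ?T"
      unfolding cut_bounded_def using cut nin finS by (simp add: add.assoc)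
    ultimately have "Ok ?T" unfolding Ok_def by blast
    from max[OF this] have "card ?T \<le> card \<S>" .
    moreover have "card ?T = card \<S> + 1" using nin finS card_Suc_Diff1[OF finS S] by simp
    ultimately show False by simp
  qed
  then show ?thesis using that[of \<S>] ok unfolding Ok_def by blast
qed

lemma cutval_le_one: "finite S \<Longrightarrow> card S \<le> 3 \<Longrightarrow> cutval v S P \<le> 1"
  using mass_compl[of S v P] unfolding cutval_def by linarith

text \<open>Double counting of pairs of a class and a crossing block that meets it. A block of at
  most three half-edges adds at most 1 to the cut of a class, so each class meets at least
  \<open>K\<close> crossing blocks, while a block meets at most three classes.\<close>

theorem partition_connected_of_cuts:
  assumes finB: "finite B" and finS: "finite \<S>"
    and blocks: "\<And>S. S \<in> \<S> \<Longrightarrow> finite S \<and> v ` S \<subseteq> B \<and> card S \<le> 3"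
    and cb: "cut_bounded B v K \<S>" and K: "3 * p \<le> K"
  shows "partition_connected B \<S> (\<lambda>S. v ` S) p"
  unfolding partition_connected_def
proof (intro allI impI)
  fix R assume R: "equiv B R"
  let ?cr = "crossing \<S> (\<lambda>S. v ` S) R"
  have finQ: "finite (B // R)" using R finB by (auto intro: finite_quotient simp: equiv_def)
  have fincr: "finite ?cr" using finS unfolding crossing_def by auto
  show "p * ncl B R \<le> card ?cr + p"
  proof (cases "ncl B R \<le> 1")
    case True
    then have "p * ncl B R \<le> p * 1" by (rule mult_le_mono2)
    then show ?thesis by linarith
  next
    case False
    have cls: "K \<le> (\<Sum>S\<in>?cr. of_bool (v ` S \<inter> C \<noteq> {}))" if C: "C \<in> B // R" for C
    proof -
      have "C \<noteq> {}" "C \<subseteq> B" using in_quotient_imp_non_empty[OF R C] in_quotient_imp_subset[OF R C] by auto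
      moreover have "C \<noteq> B"
      proof
        assume "C = B"
        have "B // R \<subseteq> {B}"
        proof
          fix X assume X: "X \<in> B // R"
          then have "X \<inter> B \<noteq> {}"
            using in_quotient_imp_non_empty[OF R X] in_quotient_imp_subset[OF R X] by auto
          then show "X \<in> {B}" using quotient_disj[OF R X C] \<open>C = B\<close> by auto
        qed
        from card_mono[OF _ this] show False using False unfolding ncl_def by simp
      qed
      ultimately have "K \<le> (\<Sum>S\<in>\<S>. cutval v S C)" using cb unfolding cut_bounded_def by blast
      also have "\<dots> \<le> (\<Sum>S\<in>\<S>. of_bool (S \<in> ?cr \<and> v ` S \<inter> C \<noteq> {}))"
      proof (rule sum_mono)
        fix S assume S: "S \<in> \<S>"
        show "cutval v S C \<le> of_bool (S \<in> ?cr \<and> v ` S \<inter> C \<noteq> {})"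
        proof (cases "cutval v S C = 0")
          case False
          then have "mass v S C \<noteq> 0" "mass v S (- C) \<noteq> 0" unfolding cutval_def by auto
          then obtain a b where ab: "a \<in> S" "v a \<in> C" "b \<in> S" "v b \<notin> C"
            unfolding mass_def using blocks[OF S] by (auto simp: of_bool_def split: if_splits)
          have "(v a, v b) \<notin> R"
            using ab C R by (metis in_quotient_imp_closed)
          then have "S \<in> ?cr" using S ab unfolding crossing_def by auto
          then show ?thesis using cutval_le_one[of S v C] blocks[OF S] ab by auto
        qed simp
      qed
      also have "\<dots> = (\<Sum>S\<in>?cr. of_bool (v ` S \<inter> C \<noteq> {}))"
        by (rule sum.mono_neutral_cong_right) (use finS in \<open>auto simp: crossing_def\<close>)
      finally show ?thesis .
    qed
    have "ncl B R * K \<le> (\<Sum>C\<in>B // R. \<Sum>S\<in>?cr. of_bool (v ` S \<inter> C \<noteq> {}))"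
      unfolding ncl_def using sum_mono[of "B // R" "\<lambda>_. K"] cls by simp
    also have "\<dots> = (\<Sum>S\<in>?cr. \<Sum>C\<in>B // R. of_bool (v ` S \<inter> C \<noteq> {}))" by (rule sum.swap)
    also have "\<dots> \<le> (\<Sum>S\<in>?cr. 3)"
    proof (rule sum_mono)
      fix S assume "S \<in> ?cr"
      then have S: "finite S" "card S \<le> 3" using blocks unfolding crossing_def by auto
      have "{C \<in> B // R. v ` S \<inter> C \<noteq> {}} \<subseteq> (\<lambda>q. R `` {v q}) ` S"
      proof
        fix C assume "C \<in> {C \<in> B // R. v ` S \<inter> C \<noteq> {}}"
        then obtain x where C: "C \<in> B // R" "x \<in> S" "v x \<in> C" by blast
        then have "C = R `` {v x}" using R
          by (metis equiv_class_eq_iff quotientE Image_singleton_iff)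
        then show "C \<in> (\<lambda>q. R `` {v q}) ` S" using C by auto
      qed
      then have le: "card {C \<in> B // R. v ` S \<inter> C \<noteq> {}} \<le> card ((\<lambda>q. R `` {v q}) ` S)"
        using S by (intro card_mono) auto
      have "(\<Sum>C\<in>B // R. of_bool (v ` S \<inter> C \<noteq> {})) = card {C \<in> B // R. v ` S \<inter> C \<noteq> {}}"
        using finQ by (simp add: Int_def)
      also note le
      also have "card ((\<lambda>q. R `` {v q}) ` S) \<le> 3" using card_image_le[OF S(1), of "\<lambda>q. R `` {v q}"] S(2) by linarith
      finally show "(\<Sum>C\<in>B // R. of_bool (v ` S \<inter> C \<noteq> {})) \<le> (3 :: nat)" .
    qed
    also have "\<dots> = card ?cr * 3" by simp
    finally have "ncl B R * (3 * p) \<le> card ?cr * 3"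
      using mult_le_mono2[OF K, of "ncl B R"] by linarith
    then have "3 * (p * ncl B R) \<le> 3 * card ?cr" by (simp add: mult.commute mult.left_commute)
    then show ?thesis by linarith
  qed
qed

section \<open>Combs\<close>

definition linked :: "'b rel \<Rightarrow> 'b set \<Rightarrow> bool" where
  "linked A S \<longleftrightarrow> (\<forall>x\<in>S. \<forall>y\<in>S. (x, y) \<in> (A \<inter> S \<times> S)\<^sup>*)"

lemma sym_restrict: "sym A \<Longrightarrow> sym ((A \<inter> S \<times> S)\<^sup>*)"
  by (intro sym_rtrancl) (auto simp: sym_def)

lemma restrict_mono: "S \<subseteq> T \<Longrightarrow> (A \<inter> S \<times> S)\<^sup>* \<subseteq> (A \<inter> T \<times> T)\<^sup>*"
  by (intro rtrancl_mono) auto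

lemma linked_rootI:
  assumes "sym A" "\<And>x. x \<in> S \<Longrightarrow> (s, x) \<in> (A \<inter> S \<times> S)\<^sup>*"
  shows "linked A S"
  unfolding linked_def
proof (intro ballI)
  fix x y assume "x \<in> S" "y \<in> S"
  then have "(x, s) \<in> (A \<inter> S \<times> S)\<^sup>*" "(s, y) \<in> (A \<inter> S \<times> S)\<^sup>*"
    using assms sym_restrict[OF assms(1), of S] by (auto dest: symD)
  then show "(x, y) \<in> (A \<inter> S \<times> S)\<^sup>*" by (rule rtrancl_trans)
qed

lemma linked_Un:
  assumes "sym A" "linked A S" "linked A T" "x \<in> S" "y \<in> T" "(x, y) \<in> A"
  shows "linked A (S \<union> T)"
proof (rule linked_rootI[OF assms(1)])
  fix u assume "u \<in> S \<union> T"
  have xy: "(x, y) \<in> (A \<inter> (S \<union> T) \<times> (S \<union> T))\<^sup>*" using assms by auto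
  show "(x, u) \<in> (A \<inter> (S \<union> T) \<times> (S \<union> T))\<^sup>*"
  proof (cases "u \<in> S")
    case True
    then have "(x, u) \<in> (A \<inter> S \<times> S)\<^sup>*" using assms(2,4) unfolding linked_def by auto
    then show ?thesis using restrict_mono[of S "S \<union> T" A] by auto
  next
    case False
    then have "(y, u) \<in> (A \<inter> T \<times> T)\<^sup>*" using \<open>u \<in> S \<union> T\<close> assms(3,5) unfolding linked_def by auto
    then have "(y, u) \<in> (A \<inter> (S \<union> T) \<times> (S \<union> T))\<^sup>*" using restrict_mono[of T "S \<union> T" A] by auto
    then show ?thesis using xy by (meson rtrancl_trans)
  qed
qed

lemma closed_path:
  assumes "(a, b) \<in> (A \<inter> U \<times> U)\<^sup>*" "a \<in> C"
    and "\<And>x y. x \<in> C \<Longrightarrow> (x, y) \<in> A \<inter> U \<times> U \<Longrightarrow> y \<in> C"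
  shows "b \<in> C \<and> (a, b) \<in> (A \<inter> C \<times> C)\<^sup>*"
  using assms(1)
proof (induction rule: rtrancl_induct)
  case base
  then show ?case using assms(2) by auto
next
  case (step x y)
  then have "y \<in> C" using assms(3) by blast
  then have "(x, y) \<in> A \<inter> C \<times> C" using step by auto
  then show ?case using step \<open>y \<in> C\<close> by (meson rtrancl.rtrancl_into_rtrancl)
qed

text \<open>C is a component of \<open>S - {s}\<close>; the other components hang on s, which is why \<open>S - C\<close> is connected.\<close>

lemma heavy_component:
  assumes sA: "sym A" and deg: "\<And>x. finite {y. (x, y) \<in> A} \<and> card {y. (x, y) \<in> A} \<le> \<Delta>"
    and finS: "finite S" and lS: "linked A S" and s: "s \<in> S"
    and big: "\<Delta> * k + 1 < card (Z \<inter> S)"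
  obtains C y where "C \<subseteq> S - {s}" "linked A C" "linked A (S - C)" "y \<in> C" "(s, y) \<in> A"
    "k \<le> card (Z \<inter> C)"
proof -
  let ?U = "S - {s}"
  let ?r = "(A \<inter> ?U \<times> ?U)\<^sup>*"
  define C where "C y = {x. (y, x) \<in> ?r}" for y
  define Y where "Y = {y \<in> ?U. (s, y) \<in> A}"
  have symr: "sym ?r" by (rule sym_restrict[OF sA])
  have CU: "C y \<subseteq> ?U" if "y \<in> ?U" for y
  proof
    fix x assume "x \<in> C y"
    then have "(y, x) \<in> ?r" unfolding C_def by auto
    then show "x \<in> ?U" using that by (induction rule: rtrancl_induct) auto
  qed
  have Cpath: "(a, b) \<in> (A \<inter> C y \<times> C y)\<^sup>*" if "a \<in> C y" "(a, b) \<in> ?r" for a b y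
  proof -
    have step: "z \<in> C y" if "x \<in> C y" "(x, z) \<in> A \<inter> ?U \<times> ?U" for x z
      using that unfolding C_def by (auto intro: rtrancl.rtrancl_into_rtrancl)
    show ?thesis using closed_path[OF that(2,1)] step by blast
  qed
  have Cself: "y \<in> C y" for y unfolding C_def by auto
  have Clinked: "linked A (C y)" for y
  proof (rule linked_rootI[OF sA])
    fix x assume "x \<in> C y"
    then show "(y, x) \<in> (A \<inter> C y \<times> C y)\<^sup>*" using Cpath[OF Cself] unfolding C_def by auto
  qed
  have cover: "x = s \<or> (\<exists>y\<in>Y. x \<in> C y)" if "x \<in> S" for x
  proof -
    have "(s, x) \<in> (A \<inter> S \<times> S)\<^sup>*" using lS s that unfolding linked_def by auto
    then show ?thesis
    proof (induction rule: rtrancl_induct)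
      case (step x z)
      show ?case
      proof (cases "z = s \<or> x = s")
        case True
        then show ?thesis using step Cself[of z] unfolding Y_def by auto
      next
        case False
        then obtain y where "y \<in> Y" "x \<in> C y" using step by auto
        moreover have "(x, z) \<in> A \<inter> ?U \<times> ?U" using step False by auto
        ultimately show ?thesis unfolding C_def by (auto intro: rtrancl.rtrancl_into_rtrancl)
      qed
    qed auto
  qed
  have finY: "finite Y" using finS unfolding Y_def by auto
  have cardY: "card Y \<le> \<Delta>"
  proof -
    have "card Y \<le> card {y. (s, y) \<in> A}" using deg[of s] unfolding Y_def by (intro card_mono) auto
    then show ?thesis using deg[of s] by linarith
  qed
  have "\<exists>y\<in>Y. k \<le> card (Z \<inter> C y)"
  proof (rule ccontr)
    assume neg: "\<not> ?thesis"
    have "Z \<inter> S \<subseteq> insert s (\<Union>y\<in>Y. Z \<inter> C y)" using cover by auto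
    moreover have fin: "finite (\<Union>y\<in>Y. Z \<inter> C y)"
      using finY CU finS finite_subset unfolding Y_def by (metis (no_types, lifting) finite_Diff finite_Int finite_UN mem_Collect_eq)
    ultimately have "card (Z \<inter> S) \<le> card (insert s (\<Union>y\<in>Y. Z \<inter> C y))" by (intro card_mono) auto
    also have "\<dots> \<le> 1 + card (\<Union>y\<in>Y. Z \<inter> C y)" using fin by (simp add: card_insert_if)
    also have "card (\<Union>y\<in>Y. Z \<inter> C y) \<le> (\<Sum>y\<in>Y. card (Z \<inter> C y))" by (rule card_UN_le[OF finY])
    also have "\<dots> \<le> (\<Sum>y\<in>Y. k)" using neg by (intro sum_mono) auto
    also have "\<dots> \<le> \<Delta> * k" using cardY by simp
    finally show False using big by simp
  qed
  then obtain y where y: "y \<in> Y" "k \<le> card (Z \<inter> C y)" by blast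
  have yU: "y \<in> ?U" "(s, y) \<in> A" using y unfolding Y_def by auto
  have "linked A (S - C y)"
  proof (rule linked_rootI[OF sA])
    fix x assume x: "x \<in> S - C y"
    have sD: "s \<in> S - C y" using CU[OF yU(1)] s by auto
    show "(s, x) \<in> (A \<inter> (S - C y) \<times> (S - C y))\<^sup>*"
    proof (cases "x = s")
      case False
      then obtain y' where y': "y' \<in> Y" "x \<in> C y'" using cover x by auto
      have "C y' \<inter> C y = {}"
      proof (rule ccontr)
        assume "C y' \<inter> C y \<noteq> {}"
        then obtain w where "(y', w) \<in> ?r" "(y, w) \<in> ?r" unfolding C_def by auto
        then have "(y, y') \<in> ?r" using symD[OF symr] by (meson rtrancl_trans)
        moreover have "(y', x) \<in> ?r" using y' unfolding C_def by auto
        ultimately have "(y, x) \<in> ?r" by (meson rtrancl_trans)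
        then show False using x unfolding C_def by auto
      qed
      then have sub: "C y' \<subseteq> S - C y" using CU[of y'] y' unfolding Y_def by auto
      have "(y', x) \<in> (A \<inter> C y' \<times> C y')\<^sup>*" using Clinked[of y'] Cself[of y'] y' unfolding linked_def by auto
      then have "(y', x) \<in> (A \<inter> (S - C y) \<times> (S - C y))\<^sup>*" using restrict_mono[OF sub] by auto
      moreover have "(s, y') \<in> A \<inter> (S - C y) \<times> (S - C y)" using y' sD sub Cself[of y'] unfolding Y_def by auto
      ultimately show ?thesis by (meson converse_rtrancl_into_rtrancl)
    qed simp
  qed
  then show ?thesis using that[of "C y" y] CU[OF yU(1)] Clinked[of y] Cself[of y] yU y by auto
qed

text \<open>Dictated by \<open>heavy_component\<close>: at most \<open>\<Delta>\<close> components
  hang on the root, which may itself carry a mark, so more than \<open>\<Delta> * k + 1\<close>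
  marks leave \<open>k\<close> in one component.\<close>

fun marks_needed :: "nat \<Rightarrow> nat \<Rightarrow> nat" where
  "marks_needed \<Delta> 0 = 1"
| "marks_needed \<Delta> (Suc N) = \<Delta> * marks_needed \<Delta> N + 2"

definition chain :: "'b rel \<Rightarrow> 'b set \<Rightarrow> nat \<Rightarrow> (nat \<Rightarrow> 'b set) \<Rightarrow> bool" where
  "chain A Z N W \<longleftrightarrow> (\<forall>i\<le>N. linked A (W i) \<and> W i \<inter> Z \<noteq> {}) \<and>
     (\<forall>i\<le>N. \<forall>j\<le>N. i \<noteq> j \<longrightarrow> W i \<inter> W j = {}) \<and>
     (\<forall>i<N. \<exists>x\<in>W i. \<exists>y\<in>W (Suc i). (x, y) \<in> A)"

text \<open>Descend into the heavy component \<open>C\<close>. If the rest has a mark, it becomes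
  the first link and \<open>N\<close> drops. If it has none, \<open>C\<close> keeps all marks,
  \<open>N\<close> stays and the rest is absorbed into the first link of the chain in
  \<open>C\<close>. Hence the induction is on the size of \<open>S\<close>.\<close>

lemma chain_exists:
  assumes sA: "sym A" and deg: "\<And>x. finite {y. (x, y) \<in> A} \<and> card {y. (x, y) \<in> A} \<le> \<Delta>"
  shows "finite S \<Longrightarrow> linked A S \<Longrightarrow> s \<in> S \<Longrightarrow> marks_needed \<Delta> N \<le> card (Z \<inter> S) \<Longrightarrow>
    \<exists>W. chain A Z N W \<and> (\<forall>i\<le>N. W i \<subseteq> S) \<and> s \<in> W 0"
proof (induction "card S" arbitrary: S s N rule: less_induct)
  case less
  show ?case
  proof (cases N)
    case 0
    then have "Z \<inter> S \<noteq> {}" using less.prems(4) by auto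
    then show ?thesis using less.prems 0 unfolding chain_def by (intro exI[of _ "\<lambda>_. S"]) auto
  next
    case (Suc N')
    have "\<Delta> * marks_needed \<Delta> N' + 1 < card (Z \<inter> S)" using less.prems(4) Suc by simp
    then obtain C y where C: "C \<subseteq> S - {s}" "linked A C" "linked A (S - C)" "y \<in> C" "(s, y) \<in> A"
      "marks_needed \<Delta> N' \<le> card (Z \<inter> C)"
      using heavy_component[OF sA deg less.prems(1-3)] by blast
    have finC: "finite C" and lt: "card C < card S"
      using C(1) less.prems(1,3) by (auto intro: finite_subset psubset_card_mono)
    have sD: "s \<in> S - C" using C(1) less.prems(3) by auto
    show ?thesis
    proof (cases "Z \<inter> (S - C) = {}")
      case True
      then have "Z \<inter> S = Z \<inter> C" using C(1) by auto
      then obtain W where W: "chain A Z N W" "\<forall>i\<le>N. W i \<subseteq> C" "y \<in> W 0"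
        using less.hyps[OF lt finC C(2,4), of N] less.prems(4) by auto
      let ?W = "W(0 := (S - C) \<union> W 0)"
      have "linked A ((S - C) \<union> W 0)"
        using W C(3,5) sD unfolding chain_def by (intro linked_Un[OF sA, of _ _ s y]) auto
      moreover have "(S - C \<union> W 0) \<inter> W j = {}" if "j \<le> N" "0 < j" for j
      proof -
        have "W 0 \<inter> W j = {}" using W(1) that unfolding chain_def by blast
        then show ?thesis using W(2) that by blast
      qed
      ultimately have "chain A Z N ?W"
        using W(1) unfolding chain_def by (auto simp: Int_commute; blast)
      moreover have "\<forall>i\<le>N. ?W i \<subseteq> S" using W(2) C(1) by auto
      ultimately show ?thesis using sD by (intro exI[of _ ?W]) auto
    next
      case False
      obtain W where W: "chain A Z N' W" "\<forall>i\<le>N'. W i \<subseteq> C" "y \<in> W 0"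
        using less.hyps[OF lt finC C(2,4,6)] by auto
      let ?W = "case_nat (S - C) W"
      have "chain A Z N ?W"
        unfolding chain_def
      proof (intro conjI allI impI)
        fix i assume "i \<le> N"
        then show "linked A (?W i)" "?W i \<inter> Z \<noteq> {}"
          using W(1) C(3) False Suc unfolding chain_def by (cases i; auto)+
      next
        fix i j assume "i \<le> N" "j \<le> N" "i \<noteq> j"
        then show "?W i \<inter> ?W j = {}"
          using W(1,2) Suc unfolding chain_def by (cases i; cases j) (simp_all, blast+)
      next
        fix i assume "i < N"
        then show "\<exists>x\<in>?W i. \<exists>y\<in>?W (Suc i). (x, y) \<in> A"
          using W(1,3) sD C(5) Suc unfolding chain_def by (cases i) auto
      qed
      moreover have "\<forall>i\<le>N. ?W i \<subseteq> S"
        using W(2) C(1) Suc by (auto split: nat.split)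
      ultimately show ?thesis using sD by (intro exI[of _ ?W]) auto
    qed
  qed
qed

lemma chain_interval:
  assumes sA: "sym A" and ch: "chain A Z N W"
  shows "i \<le> j \<Longrightarrow> j \<le> N \<Longrightarrow> linked A (\<Union>k\<in>{i..j}. W k)"
proof (induction j rule: dec_induct)
  case base
  then show ?case using ch unfolding chain_def by simp
next
  case (step j)
  obtain x y where xy: "x \<in> W j" "y \<in> W (Suc j)" "(x, y) \<in> A"
    using ch step.prems unfolding chain_def by (meson Suc_le_eq)
  have "{i..Suc j} = insert (Suc j) {i..j}" using step.hyps by auto
  then have eq: "(\<Union>k\<in>{i..Suc j}. W k) = (\<Union>k\<in>{i..j}. W k) \<union> W (Suc j)" by auto
  have "linked A (W (Suc j))" using ch step.prems unfolding chain_def by simp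
  then show ?case unfolding eq
    using step xy by (intro linked_Un[OF sA _ _ _ xy(2,3)]) auto
qed

text \<open>What remains of a comb: \<open>Q a b\<close> is its segment from \<open>z a\<close> to
  \<open>z b\<close>. Disjointness is asked only for intervals with a gap, since adjoining segments
  share an end. Having segments for all pairs makes the notion pass to subsequences.\<close>

definition combed :: "'b rel \<Rightarrow> (nat \<Rightarrow> 'b) \<Rightarrow> nat \<Rightarrow> bool" where
  "combed A z N \<longleftrightarrow> (\<exists>Q. (\<forall>a b. a < b \<longrightarrow> b < N \<longrightarrow> linked A (Q a b) \<and> z a \<in> Q a b \<and> z b \<in> Q a b) \<and>
     (\<forall>a b c d. a < b \<longrightarrow> b < c \<longrightarrow> c < d \<longrightarrow> d < N \<longrightarrow> Q a b \<inter> Q c d = {}))"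

lemma combed_subsequence:
  assumes "combed A z M" "strict_mono_on {..<N} g" "g ` {..<N} \<subseteq> {..<M}"
  shows "combed A (z \<circ> g) N"
proof -
  obtain Q where Q: "\<And>a b. a < b \<Longrightarrow> b < M \<Longrightarrow> linked A (Q a b) \<and> z a \<in> Q a b \<and> z b \<in> Q a b"
    "\<And>a b c d. a < b \<Longrightarrow> b < c \<Longrightarrow> c < d \<Longrightarrow> d < M \<Longrightarrow> Q a b \<inter> Q c d = {}"
    using assms(1) unfolding combed_def by metis
  have lt: "g a < g b" if "a < b" "b < N" for a b
    using assms(2) that by (auto simp: strict_mono_on_def)
  have "g b < M" if "b < N" for b using assms(3) that by auto
  then show ?thesis
    unfolding combed_def using Q lt
    by (intro exI[of _ "\<lambda>a b. Q (g a) (g b)"]) auto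
qed

text \<open>A chain meets the marks in an order of its own, but several systems must later agree on
  one order. With \<open>f i\<close> the index of a mark in link \<open>i\<close>, Ramsey's theorem
  makes \<open>f\<close> monotone on \<open>N\<close> links. If it decreases, the chain is read
  backwards.\<close>

theorem comb_exists:
  "\<exists>M :: nat. \<forall>(A :: 'b rel) B z. sym A \<longrightarrow> (\<forall>x. finite {y. (x, y) \<in> A} \<and> card {y. (x, y) \<in> A} \<le> \<Delta>) \<longrightarrow>
     finite B \<longrightarrow> linked A B \<longrightarrow> inj_on z {..<M} \<longrightarrow> z ` {..<M} \<subseteq> B \<longrightarrow>
     (\<exists>g. strict_mono_on {..<N} g \<and> g ` {..<N} \<subseteq> {..<M} \<and> combed A (z \<circ> g) N)"
proof -
  obtain r where "r \<ge> 1" and ram: "\<And>(V :: nat set) E. finite V \<and> card V \<ge> r \<Longrightarrow>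
      \<exists>R\<subseteq>V. card R = N \<and> clique R E \<or> card R = N \<and> indep R E"
    using ramsey2[where 'a = nat, of N N] by blast
  define M where "M = marks_needed \<Delta> r"
  show ?thesis
  proof (intro exI[of _ M] allI impI)
    fix A :: "'b rel" and B and z :: "nat \<Rightarrow> 'b"
    assume sA: "sym A" and deg: "\<forall>x. finite {y. (x, y) \<in> A} \<and> card {y. (x, y) \<in> A} \<le> \<Delta>"
      and finB: "finite B" and lB: "linked A B" and inj: "inj_on z {..<M}" and zB: "z ` {..<M} \<subseteq> B"
    have "M \<ge> 1" unfolding M_def by (cases r) auto
    then have s: "z 0 \<in> B" using zB by auto
    have "card (z ` {..<M} \<inter> B) = M" using zB inj by (simp add: Int_absorb2 card_image)
    then obtain W where W: "chain A (z ` {..<M}) r W"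
      using chain_exists[OF sA _ finB lB s, of \<Delta> r "z ` {..<M}"] deg unfolding M_def by auto
    have "\<forall>i\<le>r. \<exists>k<M. z k \<in> W i" using W unfolding chain_def by fastforce
    then obtain f where f: "\<And>i. i \<le> r \<Longrightarrow> f i < M \<and> z (f i) \<in> W i" by metis
    have Wd: "W i \<inter> W j = {}" if "i \<le> r" "j \<le> r" "i \<noteq> j" for i j
      using W that unfolding chain_def by blast
    have finj: "f i \<noteq> f j" if "i \<le> r" "j \<le> r" "i \<noteq> j" for i j
      using f[of i] f[of j] that Wd[OF that] by auto
    define E where "E = {{i, j} | i j. i < j \<and> f i < f j}"
    obtain R where R: "R \<subseteq> {..<r}" "card R = N" and RR: "clique R E \<or> indep R E"
      using ram[of "{..<r}" E] by auto
    have inE: "{i, j} \<in> E \<longleftrightarrow> f i < f j" if "i < j" for i j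
      using that unfolding E_def by (auto simp: doubleton_eq_iff)
    obtain h where h: "bij_betw h {..<N} R" "strict_mono_on {..<N} h"
      using ex_bij_betw_strict_mono_card[of R] R finite_subset by (metis finite_lessThan)
    have hR: "h k \<in> R" "h k \<le> r" if "k < N" for k
      using h(1) that R(1) unfolding bij_betw_def by force+
    have hlt: "h a < h b" if "a < b" "b < N" for a b
      using h(2) that by (auto simp: strict_mono_on_def)
    \<comment> \<open>The stretch of chain between two links, in whichever order they are given; the
      reversed case has \<open>i\<close> above \<open>j\<close>.\<close>
    define U where "U i j = (\<Union>k\<in>{min i j..max i j}. W k)" for i j
    have U: "linked A (U i j)" "z (f i) \<in> U i j" "z (f j) \<in> U i j" if "i \<le> r" "j \<le> r" for i j
      using chain_interval[OF sA W, of "min i j" "max i j"] that f[of i] f[of j] unfolding U_def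
      by (auto simp: min_def max_def)
    have Ud: "U i j \<inter> U k l = {}" if "max i j < min k l" "max k l \<le> r" for i j k l
    proof -
      have "W a \<inter> W b = {}" if "a \<in> {min i j..max i j}" "b \<in> {min k l..max k l}" for a b
      proof (rule Wd)
        show "a \<le> r" "b \<le> r" "a \<noteq> b"
          using that \<open>max i j < min k l\<close> \<open>max k l \<le> r\<close> unfolding atLeastAtMost_iff by linarith+
      qed
      then show ?thesis unfolding U_def by blast
    qed
    from RR show "\<exists>g. strict_mono_on {..<N} g \<and> g ` {..<N} \<subseteq> {..<M} \<and> combed A (z \<circ> g) N"
    proof
      assume cl: "clique R E"
      have fl: "f (h a) < f (h b)" if "a < b" "b < N" for a b
        using cl hR[of a] hR[of b] hlt[OF that] inE[OF hlt[OF that]] that by (auto simp: clique_def)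
      show ?thesis
      proof (intro exI conjI)
        show "strict_mono_on {..<N} (\<lambda>k. f (h k))" using fl by (auto simp: strict_mono_on_def)
        show "(\<lambda>k. f (h k)) ` {..<N} \<subseteq> {..<M}" using f hR by auto
        show "combed A (z \<circ> (\<lambda>k. f (h k))) N"
          unfolding combed_def
        proof (intro exI[of _ "\<lambda>a b. U (h a) (h b)"] conjI allI impI)
          fix a b c d assume "a < b" "b < c" "c < d" "d < N"
          then have "h a < h b" "h b < h c" "h c < h d" "h d \<le> r" using hlt hR by auto
          then show "U (h a) (h b) \<inter> U (h c) (h d) = {}" by (intro Ud) auto
        qed (use U hR in auto)
      qed
    next
      assume ind: "indep R E"
      have fl: "f (h b) < f (h a)" if "a < b" "b < N" for a b
        using ind hR[of a] hR[of b] hlt[OF that] inE[OF hlt[OF that]] that finj[of "h a" "h b"]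
        by (auto simp: indep_def)
      \<comment> \<open>Reading the chosen links from the last to the first turns the decreasing
        \<open>f\<close> into an increasing one.\<close>
      define h' where "h' k = h (N - 1 - k)" for k
      have h'R: "h' k \<le> r" if "k < N" for k using hR that unfolding h'_def by auto
      show ?thesis
      proof (intro exI conjI)
        show "strict_mono_on {..<N} (\<lambda>k. f (h' k))"
          using fl unfolding h'_def by (auto simp: strict_mono_on_def)
        show "(\<lambda>k. f (h' k)) ` {..<N} \<subseteq> {..<M}" using f h'R by auto
        show "combed A (z \<circ> (\<lambda>k. f (h' k))) N"
          unfolding combed_def
        proof (intro exI[of _ "\<lambda>a b. U (h' a) (h' b)"] conjI allI impI)
          fix a b c d assume "a < b" "b < c" "c < d" "d < N"
          then have "h' d < h' c" "h' c < h' b" "h' b < h' a" "h' a \<le> r"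
            using hlt h'R unfolding h'_def by auto
          then have "U (h' c) (h' d) \<inter> U (h' a) (h' b) = {}" by (intro Ud) auto
          then show "U (h' a) (h' b) \<inter> U (h' c) (h' d) = {}" by blast
        qed (use U h'R in auto)
      qed
    qed
  qed
qed

text \<open>One system at a time: take from the last one a subsequence long enough for the others.
  It stays combed for that system when thinned out further.\<close>

lemma comb_iterate:
  "\<exists>M :: nat. \<forall>(A :: nat \<Rightarrow> 'b rel) B z.
     (\<forall>j<n. sym (A j) \<and> linked (A j) B \<and> (\<forall>x. finite {y. (x, y) \<in> A j} \<and> card {y. (x, y) \<in> A j} \<le> \<Delta>)) \<longrightarrow>
     finite B \<longrightarrow> inj_on z {..<M} \<longrightarrow> z ` {..<M} \<subseteq> B \<longrightarrow>
     (\<exists>g. strict_mono_on {..<N} g \<and> g ` {..<N} \<subseteq> {..<M} \<and> (\<forall>j<n. combed (A j) (z \<circ> g) N))"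
proof (induction n)
  case 0
  show ?case by (intro exI[of _ N] allI impI exI[of _ id]) (auto simp: strict_mono_on_def)
next
  case (Suc n)
  then obtain M :: nat where M: "\<And>(A :: nat \<Rightarrow> 'b rel) B z.
     (\<forall>j<n. sym (A j) \<and> linked (A j) B \<and> (\<forall>x. finite {y. (x, y) \<in> A j} \<and> card {y. (x, y) \<in> A j} \<le> \<Delta>)) \<Longrightarrow>
     finite B \<Longrightarrow> inj_on z {..<M} \<Longrightarrow> z ` {..<M} \<subseteq> B \<Longrightarrow>
     (\<exists>g. strict_mono_on {..<N} g \<and> g ` {..<N} \<subseteq> {..<M} \<and> (\<forall>j<n. combed (A j) (z \<circ> g) N))"
    by metis
  obtain M' :: nat where M': "\<And>(A :: 'b rel) B z. sym A \<Longrightarrow>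
     (\<forall>x. finite {y. (x, y) \<in> A} \<and> card {y. (x, y) \<in> A} \<le> \<Delta>) \<Longrightarrow>
     finite B \<Longrightarrow> linked A B \<Longrightarrow> inj_on z {..<M'} \<Longrightarrow> z ` {..<M'} \<subseteq> B \<Longrightarrow>
     (\<exists>g. strict_mono_on {..<M} g \<and> g ` {..<M} \<subseteq> {..<M'} \<and> combed A (z \<circ> g) M)"
    using comb_exists[of \<Delta> M, where ?'b = 'b] by metis
  show ?case
  proof (intro exI[of _ M'] allI impI)
    fix A :: "nat \<Rightarrow> 'b rel" and B and z :: "nat \<Rightarrow> 'b"
    assume A: "\<forall>j<Suc n. sym (A j) \<and> linked (A j) B \<and>
        (\<forall>x. finite {y. (x, y) \<in> A j} \<and> card {y. (x, y) \<in> A j} \<le> \<Delta>)"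
      and finB: "finite B" and z: "inj_on z {..<M'}" "z ` {..<M'} \<subseteq> B"
    obtain g where g: "strict_mono_on {..<M} g" "g ` {..<M} \<subseteq> {..<M'}" "combed (A n) (z \<circ> g) M"
      using M'[of "A n" B z] A finB z by auto
    have "inj_on (z \<circ> g) {..<M}"
      using g(1,2) z(1) by (intro comp_inj_on strict_mono_on_imp_inj_on) (auto intro: inj_on_subset)
    moreover have "(z \<circ> g) ` {..<M} \<subseteq> B" using g(2) z(2) by auto
    ultimately obtain h where h: "strict_mono_on {..<N} h" "h ` {..<N} \<subseteq> {..<M}"
      "\<forall>j<n. combed (A j) (z \<circ> g \<circ> h) N"
      using M[of A B "z \<circ> g"] A finB by auto
    have "combed (A n) (z \<circ> g \<circ> h) N" by (rule combed_subsequence[OF g(3) h(1,2)])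
    then have "\<forall>j<Suc n. combed (A j) (z \<circ> (g \<circ> h)) N" using h(3) by (auto simp: less_Suc_eq comp_assoc)
    moreover have "strict_mono_on {..<N} (g \<circ> h)"
      unfolding strict_mono_on_def
    proof (intro allI impI)
      fix a b assume "a \<in> {..<N} \<and> b \<in> {..<N} \<and> a < b"
      then have ab: "a \<in> {..<N}" "b \<in> {..<N}" "a < b" by auto
      then have "h a < h b" using h(1) unfolding strict_mono_on_def by blast
      moreover have "h a \<in> {..<M}" "h b \<in> {..<M}" using h(2) ab by blast+
      ultimately show "(g \<circ> h) a < (g \<circ> h) b" using g(1) unfolding strict_mono_on_def by simp
    qed
    moreover have "(g \<circ> h) ` {..<N} \<subseteq> {..<M'}" using g(2) h(2) by auto
    ultimately show "\<exists>g. strict_mono_on {..<N} g \<and> g ` {..<N} \<subseteq> {..<M'} \<and> (\<forall>j<Suc n. combed (A j) (z \<circ> g) N)"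
      by blast
  qed
qed

lemma linked_of_eqcl:
  assumes "eqcl B F = B \<times> B"
  shows "linked (F \<union> F\<inverse>) B"
proof -
  let ?r = "((F \<union> F\<inverse>) \<inter> B \<times> B)\<^sup>*"
  have "sym (F \<union> F\<inverse>)" by (auto simp: sym_def)
  then have s: "sym ?r" by (rule sym_restrict)
  have "equiv B (?r \<inter> B \<times> B)"
  proof (rule equivI)
    show "sym (?r \<inter> B \<times> B)" using s by (auto simp: sym_def)
    show "trans (?r \<inter> B \<times> B)" by (rule transI) (auto intro: rtrancl_trans)
  qed (auto simp: refl_on_def)
  moreover have "F \<inter> B \<times> B \<subseteq> ?r \<inter> B \<times> B" by auto
  ultimately have "B \<times> B \<subseteq> ?r" using eqcl_least[of B "?r \<inter> B \<times> B" F] assms by auto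
  then show ?thesis unfolding linked_def by auto
qed

section \<open>Line graphs\<close>

definition star :: "'e set \<Rightarrow> ('e \<Rightarrow> 'v set) \<Rightarrow> 'v \<Rightarrow> 'e set" where
  "star V ends x = {e \<in> V. x \<in> ends e}"

lemma line_graph_edges_iff:
  "{e, f} \<in> line_graph_edges V ends \<longleftrightarrow> e \<in> V \<and> f \<in> V \<and> e \<noteq> f \<and> ends e \<inter> ends f \<noteq> {}"
  unfolding line_graph_edges_def by (auto simp: doubleton_eq_iff)

lemma k_connected_degree:
  assumes kc: "k_connected V E k" and finV: "finite V" and e: "e \<in> V"
  shows "k \<le> card {f \<in> V. f \<noteq> e \<and> {e, f} \<in> E}"
proof (rule ccontr)
  let ?X = "{f \<in> V. f \<noteq> e \<and> {e, f} \<in> E}"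
  assume "\<not> ?thesis"
  then have lt: "card ?X < k" by simp
  then have con: "connected_in E (V - ?X)" using kc unfolding k_connected_def by auto
  have "card (insert e ?X) < card V"
    using lt kc card_insert_le_m1 finV unfolding k_connected_def by (simp add: card_insert_if)
  then obtain f where f: "f \<in> V" "f \<notin> insert e ?X"
    using finV card_mono[of "insert e ?X" V] by fastforce
  then have "(e, f) \<in> {(x, y). x \<in> V - ?X \<and> y \<in> V - ?X \<and> {x, y} \<in> E}\<^sup>*"
    using con e unfolding connected_in_def by auto
  then have "f = e"
  proof (induction rule: rtrancl_induct)
    case (step x y)
    then show ?case by auto
  qed simp
  then show False using f by simp
qed

lemma minor_of_large_star:
  assumes finV: "finite V" and big: "r * t \<le> card (star V ends x)"
  shows "is_minor (LC_V t r) (LC_E t r) V (line_graph_edges V ends)"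
proof -
  have "card (LC_V t r) \<le> card (star V ends x)"
    using big unfolding LC_V_def C_edges_def by (simp add: card_cartesian_product)
  moreover have "finite (star V ends x)" using finV unfolding star_def by auto
  moreover have "finite (LC_V t r)" unfolding LC_V_def C_edges_def by auto
  ultimately obtain f where f: "f ` LC_V t r \<subseteq> star V ends x" "inj_on f (LC_V t r)"
    by (meson card_le_inj)
  show ?thesis
    unfolding is_minor_def
  proof (intro exI[of _ "\<lambda>u. {f u}"] conjI ballI impI)
    fix u assume "u \<in> LC_V t r"
    then show "{f u} \<subseteq> V" using f(1) unfolding star_def by auto
    show "connected_in (line_graph_edges V ends) {f u}" unfolding connected_in_def by auto
    show "{f u} \<noteq> {}" by simp
  next
    fix u w assume uw: "u \<in> LC_V t r" "w \<in> LC_V t r" "u \<noteq> w"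
    then show "{f u} \<inter> {f w} = {}" using f(2) by (auto dest: inj_onD)
  next
    fix u w assume uw: "u \<in> LC_V t r" "w \<in> LC_V t r" "{u, w} \<in> LC_E t r"
    then have "u \<noteq> w" unfolding LC_E_def by (auto simp: line_graph_edges_iff)
    then have "f u \<noteq> f w" using f(2) uw by (auto dest: inj_onD)
    moreover have "f u \<in> star V ends x" "f w \<in> star V ends x" using f(1) uw by auto
    ultimately show "\<exists>a\<in>{f u}. \<exists>b\<in>{f w}. {a, b} \<in> line_graph_edges V ends"
      unfolding star_def by (auto simp: line_graph_edges_iff)
  qed
qed

text \<open>The wrap-around between columns r - 1 and 0 is covered by letting column 0 be next to
  every column, which its full trees can afford.\<close>

lemma LC_E_cases:
  assumes "u \<in> LC_V t r" "w \<in> LC_V t r" "{u, w} \<in> LC_E t r"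
  shows "u \<noteq> w \<and> (fst u = fst w \<or> fst w = Suc (fst u) \<or> fst u = Suc (fst w) \<or> fst u = 0 \<or> fst w = 0)"
proof -
  obtain c j c' j' where u: "u = (c, j)" "c < r" and w: "w = (c', j')" "c' < r"
    using assms(1,2) unfolding LC_V_def C_edges_def by auto
  have "u \<noteq> w" and "C_ends r u \<inter> C_ends r w \<noteq> {}"
    using assms(3) unfolding LC_E_def by (auto simp: line_graph_edges_iff)
  then show ?thesis using u w unfolding C_ends_def by (auto simp: mod_Suc split: if_splits)
qed

section \<open>Half-edge blocks of a highly connected line graph\<close>

locale connected_line_graph =
  fixes V :: "'e set" and ends :: "'e \<Rightarrow> nat set" and t :: nat
  assumes loopless: "loopless_multigraph V ends" and t: "t \<ge> 1"
    and kc: "k_connected V (line_graph_edges V ends) (30 * t - 15)"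
begin

abbreviation E :: "'e set set" where "E \<equiv> line_graph_edges V ends"

definition B :: "nat set" where "B = {x. 15 * t - 6 \<le> card (star V ends x)}"

lemma finV: "finite V" using loopless unfolding loopless_multigraph_def by auto

lemma finite_star: "finite (star V ends x)" using finV unfolding star_def by auto

lemma ends_pair: "e \<in> V \<Longrightarrow> \<exists>x y. ends e = {x, y} \<and> x \<noteq> y"
  using loopless unfolding loopless_multigraph_def by (auto simp: card_2_iff)

lemma finB: "finite B"
proof (rule finite_subset)
  show "B \<subseteq> (\<Union>e\<in>V. ends e)"
  proof
    fix x assume "x \<in> B"
    then have "star V ends x \<noteq> {}" using t unfolding B_def by auto
    then show "x \<in> (\<Union>e\<in>V. ends e)" unfolding star_def by auto
  qed
  show "finite (\<Union>e\<in>V. ends e)" using finV ends_pair by fastforce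
qed

lemma big_end:
  assumes e: "e \<in> V"
  shows "ends e \<inter> B \<noteq> {}"
proof -
  obtain x y where xy: "ends e = {x, y}" "x \<noteq> y" using ends_pair[OF e] by auto
  have in_star: "e \<in> star V ends x" "e \<in> star V ends y" using e xy unfolding star_def by auto
  have "{f \<in> V. f \<noteq> e \<and> {e, f} \<in> E} \<subseteq> (star V ends x - {e}) \<union> (star V ends y - {e})"
    using xy unfolding star_def line_graph_edges_iff by auto
  then have "card {f \<in> V. f \<noteq> e \<and> {e, f} \<in> E} \<le> card ((star V ends x - {e}) \<union> (star V ends y - {e}))"
    using finite_star by (intro card_mono) auto
  also have "\<dots> \<le> card (star V ends x - {e}) + card (star V ends y - {e})" by (rule card_Un_le)
  finally have "30 * t - 15 \<le> card (star V ends x) - 1 + (card (star V ends y) - 1)"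
    using k_connected_degree[OF kc finV e] in_star by (simp add: finite_star)
  moreover have "1 \<le> card (star V ends x)" "1 \<le> card (star V ends y)"
    using in_star finite_star by (auto simp: Suc_le_eq card_gt_0_iff)
  ultimately have "15 * t - 6 \<le> card (star V ends x) \<or> 15 * t - 6 \<le> card (star V ends y)" by linarith
  then show ?thesis using xy unfolding B_def by auto
qed

text \<open>A pair (e, x) is the half-edge of e at its end x. Big-big edges become blocks of size two, and a small
  vertex w becomes the block of the far half-edges of the edges at w.\<close>

definition small_block :: "nat \<Rightarrow> ('e \<times> nat) set" where
  "small_block w = {(e, x). e \<in> star V ends w \<and> x \<in> ends e - {w}}"

definition blocks :: "('e \<times> nat) set set" where
  "blocks = (\<lambda>e. {e} \<times> ends e) ` {e \<in> V. ends e \<subseteq> B} \<union> small_block ` ((\<Union>e\<in>V. ends e) - B)"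

lemma small_block_big: "w \<notin> B \<Longrightarrow> (e, x) \<in> small_block w \<Longrightarrow> e \<in> V \<and> ends e = {w, x} \<and> w \<noteq> x \<and> x \<in> B"
  using ends_pair[of e] big_end[of e] unfolding small_block_def star_def by auto

lemma small_blockI: "e \<in> V \<Longrightarrow> ends e = {w, x} \<Longrightarrow> w \<noteq> x \<Longrightarrow> (e, x) \<in> small_block w"
  unfolding small_block_def star_def by auto

lemma blocks_cases:
  assumes "S \<in> blocks"
  obtains e where "e \<in> V" "ends e \<subseteq> B" "S = {e} \<times> ends e"
  | w where "w \<notin> B" "w \<in> (\<Union>e\<in>V. ends e)" "S = small_block w"
  using assms unfolding blocks_def by auto

lemma block_mem:
  assumes "S \<in> blocks" "(e, x) \<in> S"
  shows "e \<in> V \<and> x \<in> ends e \<and> x \<in> B"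
  using assms(1)
proof (cases rule: blocks_cases)
  case (2 w)
  then show ?thesis using small_block_big[of w e x] assms(2) by auto
qed (use assms(2) in auto)

lemma finite_half_edges: "finite (SIGMA e:V. ends e)"
  using finV ends_pair by (intro finite_SigmaI) (auto, fastforce)

lemma block_finite: "S \<in> blocks \<Longrightarrow> finite S"
  by (rule finite_subset[OF _ finite_half_edges]) (use block_mem in auto)

lemma finite_blocks: "finite blocks"
  by (rule finite_subset[of _ "Pow (SIGMA e:V. ends e)"]) (use block_mem finite_half_edges in auto)

lemma block_nonempty:
  assumes "S \<in> blocks"
  shows "S \<noteq> {}"
  using assms
proof (cases rule: blocks_cases)
  case (1 e)
  then show ?thesis using ends_pair[of e] by auto
next
  case (2 w)
  then obtain e where e: "e \<in> V" "w \<in> ends e" by auto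
  then obtain x where "ends e = {w, x}" "w \<noteq> x"
    using ends_pair[of e] by (metis insert_commute insert_iff singletonD)
  then show ?thesis using small_blockI[of e w x] e 2 by auto
qed

text \<open>A half-edge determines its block: if its edge has a small end, that end is unique by
  \<open>big_end\<close> and names the block; otherwise the edge itself does.\<close>

lemma blocks_disjoint: "pairwise disjnt blocks"
proof (rule pairwiseI, rule ccontr)
  fix S T assume ST: "S \<in> blocks" "T \<in> blocks" "S \<noteq> T" "\<not> disjnt S T"
  then obtain e x where ex: "(e, x) \<in> S" "(e, x) \<in> T" by (auto simp: disjnt_def)
  have char: "U = (if ends e \<subseteq> B then {e} \<times> ends e else small_block (THE w. w \<in> ends e - B))"
    if U: "U \<in> blocks" "(e, x) \<in> U" for U
    using U(1)
  proof (cases rule: blocks_cases)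
    case (1 e')
    then show ?thesis using U(2) by auto
  next
    case (2 w)
    then have "ends e = {w, x}" "w \<noteq> x" "x \<in> B" using small_block_big[of w e x] U(2) by auto
    then have "ends e - B = {w}" using 2 by auto
    then show ?thesis using 2 by auto
  qed
  show False using char[OF ST(1) ex(1)] char[OF ST(2) ex(2)] ST(3) by simp
qed

text \<open>For each block delete the edges of its half-edges on the lighter side of P; with fewer than k deletions,
  line graph connectivity gives a remaining edge across, which is impossible.\<close>

lemma blocks_cut_bounded: "cut_bounded B snd (15 * t - 6) blocks"
  unfolding cut_bounded_def
proof (intro allI impI)
  fix P assume P: "P \<noteq> {}" "P \<subset> B"
  show "15 * t - 6 \<le> (\<Sum>S\<in>blocks. cutval snd S P)"
  proof (rule ccontr)
    assume small: "\<not> ?thesis"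
    define X where "X S = (if mass snd S P \<le> mass snd S (- P) then fst ` {q \<in> S. snd q \<in> P} else fst ` {q \<in> S. snd q \<notin> P})" for S :: "('e \<times> nat) set"
    define XX where "XX = (\<Union>S\<in>blocks. X S)"
    have cX: "card (X S) \<le> cutval snd S P" if "S \<in> blocks" for S
    proof -
      have fin: "finite S" using block_finite that by auto
      then have "finite {q \<in> S. snd q \<in> P}" "finite {q \<in> S. snd q \<notin> P}" by auto
      then show ?thesis
        using card_image_le[of "{q \<in> S. snd q \<in> P}" fst] card_image_le[of "{q \<in> S. snd q \<notin> P}" fst]
        unfolding X_def cutval_def by (auto simp: mass_card[OF fin])
    qed
    have "card XX \<le> (\<Sum>S\<in>blocks. card (X S))" unfolding XX_def by (rule card_UN_le[OF finite_blocks])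
    also have "\<dots> \<le> (\<Sum>S\<in>blocks. cutval snd S P)" using cX by (intro sum_mono) auto
    finally have lt: "card XX < 15 * t - 6" using small by simp
    have "X S \<subseteq> V" if "S \<in> blocks" for S
      unfolding X_def using block_mem[OF that] by (auto split: if_splits)
    then have XV: "XX \<subseteq> V" unfolding XX_def by auto
    then have finX: "finite XX" using finV finite_subset by auto
    \<comment> \<open>Fewer than 15t - 6 deletions are fewer than 30t - 15, as t is at least
      1.\<close>
    have con: "connected_in E (V - XX)"
      using kc XV lt t unfolding k_connected_def by auto
    \<comment> \<open>The degree threshold in \<open>B\<close> equals the cut bound, so every big
      vertex keeps an edge; in particular both sides do.\<close>
    have avoid: "\<exists>e. e \<in> star V ends x - XX" if "x \<in> B" for x
    proof (rule ccontr)
      assume "\<not> ?thesis"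
      then have "star V ends x \<subseteq> XX" by auto
      from card_mono[OF finX this] show False using lt that unfolding B_def by simp
    qed
    obtain x0 where x0: "x0 \<in> P" using P by auto
    obtain y0 where y0: "y0 \<in> B" "y0 \<notin> P" using P by auto
    obtain e0 where e0: "e0 \<in> star V ends x0 - XX" using avoid[of x0] x0 P by auto
    obtain e1 where e1: "e1 \<in> star V ends y0 - XX" using avoid[of y0] y0 by auto
    \<comment> \<open>All half-edges of a block on its lighter side were deleted, so the survivors
      agree about \<open>P\<close>. This is why a walk in the line graph cannot change sides, even
      through a small vertex.\<close>
    have pure: "x \<in> P \<longleftrightarrow> y \<in> P" if "S \<in> blocks" "(e, x) \<in> S" "(f, y) \<in> S" "e \<notin> XX" "f \<notin> XX" for S e f x y
    proof (rule ccontr)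
      assume ne: "\<not> ?thesis"
      have "e \<in> X S \<or> f \<in> X S"
        using that ne unfolding X_def by (auto simp: image_iff split: if_splits)
      then show False using that unfolding XX_def by auto
    qed
    have edge: "x \<in> P \<longleftrightarrow> y \<in> P" if "e \<in> V - XX" "x \<in> ends e" "y \<in> ends e" "x \<in> B" "y \<in> B" for e x y
    proof (cases "x = y")
      case False
      then have "ends e = {x, y}" using ends_pair[of e] that by auto
      then have "{e} \<times> ends e \<in> blocks" using that unfolding blocks_def by auto
      then show ?thesis using pure[of "{e} \<times> ends e" e x e y] that by auto
    qed simp
    define side where "side e \<longleftrightarrow> ends e \<inter> P \<noteq> {}" for e
    have step: "side f" if ef: "e \<in> V - XX" "f \<in> V - XX" "{e, f} \<in> E" "side e" for e f
    proof -
      obtain u where u: "u \<in> ends e" "u \<in> ends f" using ef(3) by (auto simp: line_graph_edges_iff)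
      obtain x where x: "x \<in> ends e" "x \<in> P" using ef(4) unfolding side_def by auto
      have xB: "x \<in> B" using x P by auto
      show ?thesis
      proof (cases "u \<in> B")
        case True
        then have "u \<in> P" using edge[OF ef(1) x(1) u(1) xB] x by auto
        then show ?thesis using u unfolding side_def by auto
      next
        case False
        then have "u \<noteq> x" using xB by auto
        then have eu: "ends e = {u, x}" using u x ends_pair[of e] ef(1) by auto
        obtain y where y: "y \<in> ends f" "y \<in> B" using big_end[of f] ef(2) by auto
        then have "u \<noteq> y" using False by auto
        then have fu: "ends f = {u, y}" using u y ends_pair[of f] ef(2) by auto
        have "small_block u \<in> blocks" using False u ef unfolding blocks_def by auto
        moreover have "(e, x) \<in> small_block u" "(f, y) \<in> small_block u"
          using small_blockI eu fu \<open>u \<noteq> x\<close> \<open>u \<noteq> y\<close> ef by auto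
        ultimately have "y \<in> P" using pure[of "small_block u" e x f y] ef x by auto
        then show ?thesis using y unfolding side_def by auto
      qed
    qed
    have "(e0, e1) \<in> {(x, y). x \<in> V - XX \<and> y \<in> V - XX \<and> {x, y} \<in> E}\<^sup>*"
      using con e0 e1 unfolding connected_in_def star_def by auto
    moreover have "side e0" using e0 x0 unfolding side_def star_def by auto
    ultimately have "side e1"
    proof (induction rule: rtrancl_induct)
      case (step e f)
      then show ?case using \<open>\<And>e f. \<lbrakk>e \<in> V - XX; f \<in> V - XX; {e, f} \<in> E; side e\<rbrakk> \<Longrightarrow> side f\<close> by blast
    qed auto
    then obtain x where "x \<in> ends e1" "x \<in> P" unfolding side_def by auto
    then show False using edge[of e1 x y0] e1 y0 P unfolding star_def by auto
  qed
qed

lemma B_nonempty: "B \<noteq> {}"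
proof -
  have "V \<noteq> {}" using kc unfolding k_connected_def by auto
  then show ?thesis using big_end by auto
qed

lemma card_V_le:
  assumes "\<And>x. x \<in> B \<Longrightarrow> card (star V ends x) \<le> \<Delta>"
  shows "card V \<le> card B * \<Delta>"
proof -
  have "V \<subseteq> (\<Union>x\<in>B. star V ends x)" using big_end unfolding star_def by blast
  then have "card V \<le> card (\<Union>x\<in>B. star V ends x)" using finB finite_star by (intro card_mono) auto
  also have "\<dots> \<le> (\<Sum>x\<in>B. card (star V ends x))" by (rule card_UN_le[OF finB])
  also have "\<dots> \<le> (\<Sum>x\<in>B. \<Delta>)" using assms by (intro sum_mono)
  finally show ?thesis by simp
qed

text \<open>A piece is realised in \<open>G\<close> by its edges, which form a clique: they share a
  small vertex, or there is just one. Distinct pieces have disjoint edges, not merely disjoint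
  half-edges, because an edge with two big ends is a block of size two and is never split.\<close>

theorem spanning_systems:
  obtains \<S> :: "('e \<times> nat) set set" and \<epsilon> and F :: "nat \<Rightarrow> ('e \<times> nat) set set"
  where "finite \<S>"
    "\<And>S e x. S \<in> \<S> \<Longrightarrow> (e, x) \<in> S \<Longrightarrow> e \<in> V \<and> x \<in> ends e"
    "\<And>S T. S \<in> \<S> \<Longrightarrow> T \<in> \<S> \<Longrightarrow> S \<noteq> T \<Longrightarrow> fst ` S \<inter> fst ` T = {}"
    "\<And>S e f. S \<in> \<S> \<Longrightarrow> e \<in> fst ` S \<Longrightarrow> f \<in> fst ` S \<Longrightarrow> ends e \<inter> ends f \<noteq> {}"
    "\<And>S. S \<in> \<S> \<Longrightarrow> \<epsilon> S \<in> snd ` S \<times> snd ` S"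
    "\<And>S. S \<in> \<S> \<Longrightarrow> snd ` S \<subseteq> B"
    "\<And>j. j < 3 * t \<Longrightarrow> F j \<subseteq> \<S>"
    "\<And>j k. j < 3 * t \<Longrightarrow> k < 3 * t \<Longrightarrow> j \<noteq> k \<Longrightarrow> F j \<inter> F k = {}"
    "\<And>j. j < 3 * t \<Longrightarrow> eqcl B (\<epsilon> ` F j) = B \<times> B"
proof -
  have blk: "finite T \<and> snd ` T \<subseteq> B \<and> T \<noteq> {}" if "T \<in> blocks" for T
    using block_finite[OF that] block_nonempty[OF that] block_mem[OF that] by auto
  have "15 * t - 6 \<ge> 2" using t by simp
  from splitting[OF finB finite_blocks this blk blocks_disjoint blocks_cut_bounded]
  obtain \<S> where dis: "pairwise disjnt \<S>" and S3: "\<And>S. S \<in> \<S> \<Longrightarrow> S \<noteq> {} \<and> card S \<le> 3"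
    and orig: "\<And>S. S \<in> \<S> \<Longrightarrow> S \<in> blocks \<or> (\<exists>T\<in>blocks. 4 \<le> card T \<and> S \<subseteq> T)"
    and cb: "cut_bounded B snd (15 * t - 6) \<S>"
    by metis
  have parent: "\<exists>T\<in>blocks. S \<subseteq> T \<and> (S = T \<or> 4 \<le> card T)" if "S \<in> \<S>" for S
    using orig[OF that] by auto
  have mem: "e \<in> V \<and> x \<in> ends e \<and> x \<in> B" if "S \<in> \<S>" "(e, x) \<in> S" for S e x
    using parent[OF that(1)] block_mem that(2) by blast
  have finS: "finite \<S>"
    by (rule finite_subset[of _ "Pow (SIGMA e:V. ends e)"]) (use mem finite_half_edges in auto)
  have Sfin: "finite S \<and> snd ` S \<subseteq> B \<and> card S \<le> 3" if "S \<in> \<S>" for S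
  proof -
    have "S \<subseteq> (SIGMA e:V. ends e)" using mem[OF that] by auto
    then show ?thesis using finite_subset[OF _ finite_half_edges] S3[OF that] mem[OF that] by auto
  qed
  have big: "S = {e} \<times> ends e" if S: "S \<in> \<S>" "(e, x) \<in> S" "ends e \<subseteq> B" for S e x
  proof -
    obtain T where T: "T \<in> blocks" "S \<subseteq> T" "S = T \<or> 4 \<le> card T" using parent[OF S(1)] by auto
    show ?thesis
      using T(1)
    proof (cases rule: blocks_cases)
      case (1 e')
      then have "e' = e" using T S by auto
      moreover have "card ({e} \<times> ends e) = 2"
        using loopless 1 \<open>e' = e\<close> unfolding loopless_multigraph_def by (simp add: card_cartesian_product)
      ultimately show ?thesis using T 1 by auto
    next
      case (2 w)
      then show ?thesis using small_block_big[of w e x] T S by auto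
    qed
  qed
  have disj: "fst ` S \<inter> fst ` T = {}" if ST: "S \<in> \<S>" "T \<in> \<S>" "S \<noteq> T" for S T
  proof (rule ccontr)
    assume "\<not> ?thesis"
    then obtain e x y where e: "(e, x) \<in> S" "(e, y) \<in> T" by force
    have nd: "S \<inter> T = {}" using dis ST unfolding pairwise_def disjnt_def by blast
    then have "x \<noteq> y" using e by auto
    moreover have m: "e \<in> V" "x \<in> ends e" "y \<in> ends e" "x \<in> B" "y \<in> B" using mem ST e by blast+
    ultimately have "ends e \<subseteq> B" using ends_pair[of e] by auto
    then show False using big[OF ST(1) e(1)] big[OF ST(2) e(2)] ST(3) by simp
  qed
  have clique: "ends e \<inter> ends f \<noteq> {}" if S: "S \<in> \<S>" "e \<in> fst ` S" "f \<in> fst ` S" for S e f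
  proof -
    obtain T where T: "T \<in> blocks" "S \<subseteq> T" using parent[OF S(1)] by auto
    obtain x y where xy: "(e, x) \<in> T" "(f, y) \<in> T" using S T by (auto, blast)
    show ?thesis
      using T(1)
    proof (cases rule: blocks_cases)
      case (1 e')
      then show ?thesis using xy by auto
    next
      case (2 w)
      then show ?thesis using xy unfolding small_block_def star_def by auto
    qed
  qed
  have "3 * (3 * t) \<le> 15 * t - 6" using t by simp
  then have pc: "partition_connected B \<S> (\<lambda>S. snd ` S) (3 * t)"
    using partition_connected_of_cuts[OF finB finS Sfin cb] by simp
  obtain \<epsilon> where \<epsilon>: "\<And>S. S \<in> \<S> \<Longrightarrow> \<epsilon> S \<in> snd ` S \<times> snd ` S"
    "\<And>R. equiv B R \<Longrightarrow> 3 * t * ncl B R \<le> card {S \<in> \<S>. \<epsilon> S \<notin> R} + 3 * t"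
  proof (rule trimming[OF finB finS _ pc])
    show "snd ` S \<subseteq> B \<and> snd ` S \<noteq> {}" if "S \<in> \<S>" for S
      using Sfin[OF that] S3[OF that] by auto
  qed blast
  have \<epsilon>B: "\<epsilon> S \<in> B \<times> B" if "S \<in> \<S>" for S
    using \<epsilon>(1)[OF that] Sfin[OF that] by (meson Sigma_mono subsetD)
  interpret packing B \<S> \<epsilon> "3 * t"
    by unfold_locales (use finB B_nonempty finS \<epsilon>B t \<epsilon>(2) in auto)
  obtain F :: "nat \<Rightarrow> ('e \<times> nat) set set" where F: "\<And>j. j < 3 * t \<Longrightarrow> F j \<subseteq> \<S>"
    "\<And>j k. j < 3 * t \<Longrightarrow> k < 3 * t \<Longrightarrow> j \<noteq> k \<Longrightarrow> F j \<inter> F k = {}"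
    "\<And>j. j < 3 * t \<Longrightarrow> eqcl B (\<epsilon> ` F j) = B \<times> B"
    using packing_exists by blast
  show ?thesis
  proof (rule that[of \<S> \<epsilon> F])
    show "e \<in> V \<and> x \<in> ends e" if "S \<in> \<S>" "(e, x) \<in> S" for S e x
      using mem[OF that] by auto
    show "snd ` S \<subseteq> B" if "S \<in> \<S>" for S using Sfin[OF that] by auto
  qed (fact finS disj clique \<epsilon>(1) F)+
qed

end

section \<open>Branch sets from spanning systems\<close>

locale spanning_system = connected_line_graph V ends t
  for V :: "'e set" and ends :: "'e \<Rightarrow> nat set" and t :: nat +
  fixes \<S> :: "('e \<times> nat) set set" and \<epsilon> :: "('e \<times> nat) set \<Rightarrow> nat \<times> nat"
    and F :: "nat \<Rightarrow> ('e \<times> nat) set set"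
  assumes finS: "finite \<S>"
    and mem: "\<And>S e x. S \<in> \<S> \<Longrightarrow> (e, x) \<in> S \<Longrightarrow> e \<in> V \<and> x \<in> ends e"
    and edges_disjoint: "\<And>S T. S \<in> \<S> \<Longrightarrow> T \<in> \<S> \<Longrightarrow> S \<noteq> T \<Longrightarrow> fst ` S \<inter> fst ` T = {}"
    and clique: "\<And>S e f. S \<in> \<S> \<Longrightarrow> e \<in> fst ` S \<Longrightarrow> f \<in> fst ` S \<Longrightarrow> ends e \<inter> ends f \<noteq> {}"
    and \<epsilon>_mem: "\<And>S. S \<in> \<S> \<Longrightarrow> \<epsilon> S \<in> snd ` S \<times> snd ` S"
    and snd_B: "\<And>S. S \<in> \<S> \<Longrightarrow> snd ` S \<subseteq> B"
    and F_sub: "\<And>j. j < 3 * t \<Longrightarrow> F j \<subseteq> \<S>"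
    and F_disj: "\<And>j k. j < 3 * t \<Longrightarrow> k < 3 * t \<Longrightarrow> j \<noteq> k \<Longrightarrow> F j \<inter> F k = {}"
    and F_span: "\<And>j. j < 3 * t \<Longrightarrow> eqcl B (\<epsilon> ` F j) = B \<times> B"
begin

definition adj :: "nat \<Rightarrow> nat rel" where
  "adj j = \<epsilon> ` F j \<union> (\<epsilon> ` F j)\<inverse>"

definition inside :: "nat \<Rightarrow> nat set \<Rightarrow> ('e \<times> nat) set set" where
  "inside j Q = {S \<in> F j. \<epsilon> S \<in> Q \<times> Q}"

text \<open>Whole pieces are taken, so some edges may end at a third big vertex outside
  \<open>Q\<close>, the one trimmed away. This does no harm, since branch sets only have to be
  disjoint as edge sets.\<close>

definition branch :: "nat \<Rightarrow> nat set \<Rightarrow> 'e set" where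
  "branch j Q = (\<Union>S\<in>inside j Q. fst ` S)"

lemma branch_iff: "e \<in> branch j Q \<longleftrightarrow> (\<exists>S\<in>inside j Q. e \<in> fst ` S)"
  unfolding branch_def by blast

lemma inside_subset: "j < 3 * t \<Longrightarrow> S \<in> inside j Q \<Longrightarrow> S \<in> F j \<and> S \<in> \<S>"
  using F_sub unfolding inside_def by auto

lemma sym_adj: "sym (adj j)" unfolding adj_def sym_def by auto

lemma linked_adj: "j < 3 * t \<Longrightarrow> linked (adj j) B"
  unfolding adj_def by (rule linked_of_eqcl[OF F_span])

lemma adj_witness:
  assumes "j < 3 * t" "(x, y) \<in> adj j" "x \<in> Q" "y \<in> Q"
  obtains S e f where "S \<in> inside j Q" "e \<in> fst ` S" "x \<in> ends e" "f \<in> fst ` S" "y \<in> ends f"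
proof -
  obtain S where S: "S \<in> F j" "\<epsilon> S = (x, y) \<or> \<epsilon> S = (y, x)"
    using assms(2) unfolding adj_def by force
  have SS: "S \<in> \<S>" using S F_sub[OF assms(1)] by auto
  have "x \<in> snd ` S \<and> y \<in> snd ` S" using \<epsilon>_mem[OF SS] S(2) by (metis mem_Sigma_iff)
  then obtain e f where "(e, x) \<in> S" "(f, y) \<in> S" by auto
  then have "e \<in> fst ` S" "x \<in> ends e" "f \<in> fst ` S" "y \<in> ends f"
    using mem[OF SS] by force+
  moreover have "S \<in> inside j Q" using S assms unfolding inside_def by auto
  ultimately show ?thesis using that by blast
qed

text \<open>Each neighbour of \<open>x\<close> comes from a piece containing a half-edge at
  \<open>x\<close>, and distinct pieces supply distinct edges at \<open>x\<close>.\<close>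

lemma adj_degree:
  assumes "j < 3 * t"
  shows "finite {y. (x, y) \<in> adj j} \<and> card {y. (x, y) \<in> adj j} \<le> card (star V ends x)"
proof -
  let ?T = "{S \<in> \<S>. x \<in> snd ` S}"
  have "\<exists>e. (e, x) \<in> S" if "S \<in> ?T" for S using that by auto
  then obtain g where g: "\<And>S. S \<in> ?T \<Longrightarrow> (g S, x) \<in> S" by metis
  have "inj_on g ?T"
  proof (rule inj_onI, rule ccontr)
    fix S T assume ST: "S \<in> ?T" "T \<in> ?T" "g S = g T" "S \<noteq> T"
    then have "g S \<in> fst ` S" "g S \<in> fst ` T" using g[OF ST(1)] g[OF ST(2)] by force+
    then show False using edges_disjoint[of S T] ST by auto
  qed
  moreover have "g ` ?T \<subseteq> star V ends x" using g mem unfolding star_def by fastforce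
  ultimately have c: "card ?T \<le> card (star V ends x)" using finite_star card_inj_on_le by blast
  have "{y. (x, y) \<in> adj j} \<subseteq> (\<lambda>S. if fst (\<epsilon> S) = x then snd (\<epsilon> S) else fst (\<epsilon> S)) ` ?T"
  proof
    fix y assume "y \<in> {y. (x, y) \<in> adj j}"
    then obtain S where S: "S \<in> F j" "\<epsilon> S = (x, y) \<or> \<epsilon> S = (y, x)" unfolding adj_def by force
    have "S \<in> ?T" using S F_sub[OF assms] \<epsilon>_mem[of S] by (auto simp del: image_iff)
    moreover have "y = (if fst (\<epsilon> S) = x then snd (\<epsilon> S) else fst (\<epsilon> S))"
      using S(2) by (elim disjE) (simp_all)
    ultimately show "y \<in> (\<lambda>S. if fst (\<epsilon> S) = x then snd (\<epsilon> S) else fst (\<epsilon> S)) ` ?T" by blast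
  qed
  moreover have fT: "finite ?T" using finS by auto
  ultimately have "finite {y. (x, y) \<in> adj j}" "card {y. (x, y) \<in> adj j} \<le> card ?T"
    using surj_card_le[OF fT] finite_subset[OF _ finite_imageI[OF fT]] by blast+
  then show ?thesis using c by linarith
qed

lemma branch_subset:
  assumes "j < 3 * t"
  shows "branch j Q \<subseteq> V"
proof
  fix e assume "e \<in> branch j Q"
  then obtain S where "S \<in> inside j Q" "e \<in> fst ` S" unfolding branch_iff by blast
  then show "e \<in> V" using inside_subset[OF assms, of S Q] mem[of S] by auto
qed

lemma branch_touches:
  assumes j: "j < 3 * t" and lQ: "linked (adj j) Q" and x: "x \<in> Q" "y \<in> Q" "x \<noteq> y"
  shows "\<exists>e\<in>branch j Q. x \<in> ends e"
proof -
  have "(x, y) \<in> (adj j \<inter> Q \<times> Q)\<^sup>*" using lQ x unfolding linked_def by auto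
  then obtain w where "(x, w) \<in> adj j" "w \<in> Q" using x(3) by (auto elim: converse_rtranclE)
  then obtain S e where S: "S \<in> inside j Q" "e \<in> fst ` S" "x \<in> ends e"
    using adj_witness[OF j _ x(1)] by metis
  then have "e \<in> branch j Q" unfolding branch_iff by (intro bexI)
  then show ?thesis using S(3) by (rule bexI[rotated])
qed

text \<open>A walk in \<open>Q\<close> lifts to the line graph: a step from \<open>y\<close> to
  \<open>z\<close> is made inside the clique of one piece, from an edge at \<open>y\<close> to an
  edge at \<open>z\<close>, and edges at a common vertex are adjacent.\<close>

lemma branch_connected:
  assumes j: "j < 3 * t" and lQ: "linked (adj j) Q"
  shows "connected_in E (branch j Q)"
proof -
  let ?M = "branch j Q"
  let ?G = "{(e, f). e \<in> ?M \<and> f \<in> ?M \<and> {e, f} \<in> E}\<^sup>*"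
  have share: "(e, f) \<in> ?G" if "e \<in> ?M" "f \<in> ?M" "ends e \<inter> ends f \<noteq> {}" for e f
  proof (cases "e = f")
    case False
    then have "{e, f} \<in> E" using that branch_subset[OF j] by (auto simp: line_graph_edges_iff)
    then show ?thesis using that by auto
  qed simp
  have walk: "\<forall>f\<in>?M. y \<in> ends f \<longrightarrow> (e, f) \<in> ?G"
    if "(x, y) \<in> (adj j \<inter> Q \<times> Q)\<^sup>*" "e \<in> ?M" "x \<in> ends e" for e x y
    using that(1)
  proof (induction rule: rtrancl_induct)
    case base
    then show ?case using share that(2,3) by auto
  next
    case (step y z)
    obtain S f g where S: "S \<in> inside j Q" "f \<in> fst ` S" "y \<in> ends f" "g \<in> fst ` S" "z \<in> ends g"
      using adj_witness[OF j, of y z Q] step.hyps by blast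
    have fg: "f \<in> ?M" "g \<in> ?M" using S unfolding branch_iff by blast+
    have "ends f \<inter> ends g \<noteq> {}" using clique[of S f g] S inside_subset[OF j] by blast
    then have "(f, g) \<in> ?G" using share fg by blast
    then have eg: "(e, g) \<in> ?G" using step.IH fg S(3) by (meson rtrancl_trans)
    show ?case
    proof (intro ballI impI)
      fix h assume "h \<in> ?M" "z \<in> ends h"
      then have "(g, h) \<in> ?G" using share fg S(5) by blast
      then show "(e, h) \<in> ?G" using eg by (rule rtrancl_trans[rotated])
    qed
  qed
  \<comment> \<open>An edge may end in \<open>Q\<close> only through another edge of its piece, so
    it is first linked to the one that ends at the first vertex of the trimmed pair.\<close>
  have anchor: "\<exists>x\<in>Q. \<exists>f\<in>?M. x \<in> ends f \<and> (e, f) \<in> ?G \<and> (f, e) \<in> ?G" if e: "e \<in> ?M" for e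
  proof -
    obtain S where S: "S \<in> inside j Q" "e \<in> fst ` S" using e unfolding branch_iff by blast
    have SS: "S \<in> \<S>" using S inside_subset[OF j] by blast
    have "fst (\<epsilon> S) \<in> Q" "fst (\<epsilon> S) \<in> snd ` S"
      using \<epsilon>_mem[OF SS] S(1) unfolding inside_def by (simp_all add: mem_Times_iff)
    then obtain x f where x: "x \<in> Q" and f: "(f, x) \<in> S" by auto
    then have "f \<in> fst ` S" by force
    then have "f \<in> ?M" "ends e \<inter> ends f \<noteq> {}" using S clique[OF SS S(2)] unfolding branch_iff by blast+
    then show ?thesis using share[of e f] share[of f e] e x mem[OF SS f] by (auto simp: Int_commute)
  qed
  show ?thesis
    unfolding connected_in_def
  proof (intro ballI)
    fix e f assume "e \<in> ?M" "f \<in> ?M"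
    then obtain x e' y f' where *: "x \<in> Q" "e' \<in> ?M" "x \<in> ends e'" "(e, e') \<in> ?G"
      "y \<in> Q" "f' \<in> ?M" "y \<in> ends f'" "(f', f) \<in> ?G" using anchor[of e] anchor[of f] by blast
    have "(x, y) \<in> (adj j \<inter> Q \<times> Q)\<^sup>*" using lQ * unfolding linked_def by auto
    then have "(e', f') \<in> ?G" using walk * by blast
    then show "(e, f) \<in> ?G" using * by (meson rtrancl_trans)
  qed
qed

lemma branch_disjoint:
  assumes "j < 3 * t" "k < 3 * t" "j \<noteq> k \<or> Q \<inter> Q' = {}"
  shows "branch j Q \<inter> branch k Q' = {}"
proof (rule ccontr)
  assume "\<not> ?thesis"
  then obtain e where "e \<in> branch j Q" "e \<in> branch k Q'" by blast
  then obtain S T where S: "S \<in> inside j Q" "e \<in> fst ` S" and T: "T \<in> inside k Q'" "e \<in> fst ` T"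
    unfolding branch_iff by blast
  have "S \<in> \<S>" "T \<in> \<S>" using inside_subset[OF assms(1) S(1)] inside_subset[OF assms(2) T(1)] by auto
  then have "S = T" using edges_disjoint[of S T] S(2) T(2) by blast
  then show False
    using S(1) T(1) F_disj[OF assms(1,2)] assms(3) unfolding inside_def by (auto simp: mem_Times_iff)
qed

text \<open>Column 0 consists of t full trees. The remaining columns use two further groups of t trees
  alternately, column c being restricted to the comb segments from \<open>z (c - 1)\<close> to \<open>z c\<close>.\<close>

lemma minor_of_combs:
  assumes r: "r \<ge> 3" and zB: "\<And>c. c < r \<Longrightarrow> z c \<in> B" and inj: "inj_on z {..<r}"
    and comb: "\<And>j. j < 3 * t \<Longrightarrow> combed (adj j) z r"
  shows "is_minor (LC_V t r) (LC_E t r) V E"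
proof -
  have "\<forall>j. \<exists>Q. j < 3 * t \<longrightarrow>
     (\<forall>a b. a < b \<longrightarrow> b < r \<longrightarrow> linked (adj j) (Q a b) \<and> z a \<in> Q a b \<and> z b \<in> Q a b) \<and>
     (\<forall>a b c d. a < b \<longrightarrow> b < c \<longrightarrow> c < d \<longrightarrow> d < r \<longrightarrow> Q a b \<inter> Q c d = {})"
    using comb unfolding combed_def by (intro allI) metis
  then obtain Q where Q:
    "\<And>j a b. j < 3 * t \<Longrightarrow> a < b \<Longrightarrow> b < r \<Longrightarrow> linked (adj j) (Q j a b) \<and> z a \<in> Q j a b \<and> z b \<in> Q j a b"
    "\<And>j a b c d. j < 3 * t \<Longrightarrow> a < b \<Longrightarrow> b < c \<Longrightarrow> c < d \<Longrightarrow> d < r \<Longrightarrow> Q j a b \<inter> Q j c d = {}"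
    by metis
  \<comment> \<open>Systems below t serve column 0, those from t to 2t - 1 the other even columns,
    and those from 2t on the odd columns.\<close>
  define idx where "idx u = (if fst u = 0 then snd u else t + (fst u mod 2) * t + snd u)" for u :: "nat \<times> nat"
  define U where "U u = (if fst u = 0 then B else Q (idx u) (fst u - 1) (fst u))" for u :: "nat \<times> nat"
  define \<phi> where "\<phi> u = branch (idx u) (U u)" for u
  have LC: "u \<in> LC_V t r \<longleftrightarrow> fst u < r \<and> snd u < t" for u
    unfolding LC_V_def C_edges_def by (cases u) auto
  have idx: "idx u < 3 * t" if "u \<in> LC_V t r" for u
    using that unfolding LC idx_def by (cases "fst u mod 2 = 0") auto
  have idx_eq: "snd u = snd w \<and> (fst u = 0 \<longleftrightarrow> fst w = 0) \<and> (fst u \<noteq> 0 \<longrightarrow> fst u mod 2 = fst w mod 2)"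
    if "u \<in> LC_V t r" "w \<in> LC_V t r" "idx u = idx w" for u w
    using that unfolding LC idx_def
    by (cases "fst u mod 2 = 0"; cases "fst w mod 2 = 0") (auto split: if_splits)
  have lU: "linked (adj (idx u)) (U u)" if "u \<in> LC_V t r" for u
    using linked_adj[OF idx[OF that]] Q(1)[OF idx[OF that], of "fst u - 1" "fst u"] that
    unfolding U_def LC by auto
  have zU: "z (fst u) \<in> U u" "fst u \<noteq> 0 \<Longrightarrow> z (fst u - 1) \<in> U u" "fst u = 0 \<Longrightarrow> c < r \<Longrightarrow> z c \<in> U u"
    if "u \<in> LC_V t r" for u c
    using Q(1)[OF idx[OF that], of "fst u - 1" "fst u"] zB that unfolding U_def LC by auto
  have two: "\<exists>y\<in>U u. y \<noteq> x" if u: "u \<in> LC_V t r" for u x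
  proof -
    obtain a b where ab: "a < r" "b < r" "a \<noteq> b" "z a \<in> U u" "z b \<in> U u"
    proof (cases "fst u = 0")
      case True
      then show ?thesis using that[of 0 1] zU(3)[OF u, of 0] zU(3)[OF u, of 1] r by auto
    next
      case False
      then show ?thesis using that[of "fst u - 1" "fst u"] zU(1,2)[OF u] u unfolding LC by auto
    qed
    then have "z a \<noteq> z b" using inj by (auto dest: inj_onD)
    then show ?thesis using ab by metis
  qed
  have touch: "\<exists>e\<in>\<phi> u. x \<in> ends e" if u: "u \<in> LC_V t r" "x \<in> U u" for u x
  proof -
    obtain y where "y \<in> U u" "y \<noteq> x" using two[OF u(1)] by auto
    then show ?thesis using branch_touches[OF idx[OF u(1)] lU[OF u(1)] u(2), of y] unfolding \<phi>_def by auto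
  qed
  have disj: "\<phi> u \<inter> \<phi> w = {}" if uw: "u \<in> LC_V t r" "w \<in> LC_V t r" "u \<noteq> w" "fst u \<le> fst w" for u w
  proof (cases "idx u = idx w")
    case True
    note eq = idx_eq[OF uw(1,2) True]
    then have lt: "fst u < fst w" using uw(3,4) by (metis le_neq_implies_less prod.expand)
    then have pos: "fst u \<noteq> 0" using eq by auto
    then have "fst u mod 2 = fst w mod 2" using eq by auto
    \<comment> \<open>Different columns of equal parity leave the gap between their segments that
      \<open>combed\<close> asks for.\<close>
    then have "fst u < fst w - 1" using lt by presburger
    then have "U u \<inter> U w = {}"
      using Q(2)[OF idx[OF uw(1)], of "fst u - 1" "fst u" "fst w - 1" "fst w"] pos True uw(2)
      unfolding U_def LC by auto
    then show ?thesis unfolding \<phi>_def using branch_disjoint[OF idx[OF uw(1)] idx[OF uw(2)]] by blast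
  next
    case False
    then show ?thesis unfolding \<phi>_def using branch_disjoint[OF idx[OF uw(1)] idx[OF uw(2)]] by blast
  qed
  have disj': "\<phi> u \<inter> \<phi> w = {}" if "u \<in> LC_V t r" "w \<in> LC_V t r" "u \<noteq> w" for u w
    using disj[of u w] disj[of w u] that by (metis Int_commute nat_le_linear)
  show ?thesis
    unfolding is_minor_def
  proof (intro exI[of _ \<phi>] conjI ballI impI)
    fix u assume u: "u \<in> LC_V t r"
    show "\<phi> u \<noteq> {}" using touch[OF u zU(1)[OF u]] by auto
    show "\<phi> u \<subseteq> V" unfolding \<phi>_def by (rule branch_subset[OF idx[OF u]])
    show "connected_in E (\<phi> u)" unfolding \<phi>_def by (rule branch_connected[OF idx[OF u] lU[OF u]])
  next
    fix u w assume "u \<in> LC_V t r" "w \<in> LC_V t r" "u \<noteq> w"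
    then show "\<phi> u \<inter> \<phi> w = {}" by (rule disj')
  next
    fix u w assume u: "u \<in> LC_V t r" and w: "w \<in> LC_V t r" and uw: "{u, w} \<in> LC_E t r"
    note cs = LC_E_cases[OF u w uw]
    have lt: "fst u < r" "fst w < r" using u w LC by auto
    \<comment> \<open>The common vertex is \<open>z\<close> at the column itself, at the smaller of
      two consecutive columns, or, if one column is 0, at the other column.\<close>
    have "\<exists>x. x \<in> U u \<and> x \<in> U w"
      using cs zU[OF u] zU[OF w] lt by (metis Zero_not_Suc diff_Suc_1)
    then obtain x e f where "e \<in> \<phi> u" "x \<in> ends e" "f \<in> \<phi> w" "x \<in> ends f"
      using touch[OF u] touch[OF w] by blast
    moreover have "\<phi> u \<subseteq> V" "\<phi> w \<subseteq> V" unfolding \<phi>_def using branch_subset idx u w by auto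
    moreover have "e \<noteq> f" using disj'[OF u w] cs calculation by auto
    ultimately show "\<exists>e\<in>\<phi> u. \<exists>f\<in>\<phi> w. {e, f} \<in> E" by (auto simp: line_graph_edges_iff)
  qed
qed

end

theorem theorem1p6:
  fixes t r :: nat
  assumes "t \<ge> 1" and "r \<ge> 3"
  shows "\<exists>f :: nat. \<forall>(V :: 'a set) E.
           simple_graph V E \<and> k_connected V E (30 * t - 15) \<and> is_line_graph V E \<and> card V \<ge> f
           \<longrightarrow> is_minor (LC_V t r) (LC_E t r) V E"
proof -
  let ?\<Delta> = "r * t"
  obtain M :: nat where M: "\<And>(A :: nat \<Rightarrow> nat rel) B z.
     (\<forall>j<3 * t. sym (A j) \<and> linked (A j) B \<and> (\<forall>x. finite {y. (x, y) \<in> A j} \<and> card {y. (x, y) \<in> A j} \<le> ?\<Delta>)) \<Longrightarrow>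
     finite B \<Longrightarrow> inj_on z {..<M} \<Longrightarrow> z ` {..<M} \<subseteq> B \<Longrightarrow>
     (\<exists>g. strict_mono_on {..<r} g \<and> g ` {..<r} \<subseteq> {..<M} \<and> (\<forall>j<3 * t. combed (A j) (z \<circ> g) r))"
    using comb_iterate[of "3 * t" ?\<Delta> r, where ?'b = nat] by metis
  show ?thesis
  \<comment> \<open>Every edge of \<open>H\<close> has an end in \<open>B\<close>. With degrees at
    most \<open>r * t\<close>, this many edges force at least \<open>M\<close> big vertices, the
    number that \<open>comb_iterate\<close> asks for.\<close>
  proof (intro exI[of _ "M * ?\<Delta>"] allI impI)
    fix V :: "'a set" and E
    assume G: "simple_graph V E \<and> k_connected V E (30 * t - 15) \<and> is_line_graph V E \<and> M * ?\<Delta> \<le> card V"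
    then obtain ends :: "'a \<Rightarrow> nat set" where ends: "loopless_multigraph V ends" "E = line_graph_edges V ends"
      unfolding is_line_graph_def by auto
    interpret connected_line_graph V ends t
      by unfold_locales (use ends G assms in auto)
    show "is_minor (LC_V t r) (LC_E t r) V E"
    proof (cases "\<exists>x. ?\<Delta> \<le> card (star V ends x)")
      case True
      then obtain x where "?\<Delta> \<le> card (star V ends x)" by blast
      then show ?thesis unfolding ends(2) by (rule minor_of_large_star[OF finV])
    next
      case False
      then have deg: "card (star V ends x) \<le> ?\<Delta>" for x by (meson nat_le_linear)
      obtain \<S> :: "('a \<times> nat) set set" and \<epsilon> and F where sys: "spanning_system V ends t \<S> \<epsilon> F"
      proof (rule spanning_systems)
        fix \<S> :: "('a \<times> nat) set set" and \<epsilon> F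
        assume "finite \<S>"
          "\<And>S e x. S \<in> \<S> \<Longrightarrow> (e, x) \<in> S \<Longrightarrow> e \<in> V \<and> x \<in> ends e"
          "\<And>S T. S \<in> \<S> \<Longrightarrow> T \<in> \<S> \<Longrightarrow> S \<noteq> T \<Longrightarrow> fst ` S \<inter> fst ` T = {}"
          "\<And>S e f. S \<in> \<S> \<Longrightarrow> e \<in> fst ` S \<Longrightarrow> f \<in> fst ` S \<Longrightarrow> ends e \<inter> ends f \<noteq> {}"
          "\<And>S. S \<in> \<S> \<Longrightarrow> \<epsilon> S \<in> snd ` S \<times> snd ` S"
          "\<And>S. S \<in> \<S> \<Longrightarrow> snd ` S \<subseteq> B"
          "\<And>j. j < 3 * t \<Longrightarrow> F j \<subseteq> \<S>"
          "\<And>j k. j < 3 * t \<Longrightarrow> k < 3 * t \<Longrightarrow> j \<noteq> k \<Longrightarrow> F j \<inter> F k = {}"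
          "\<And>j. j < 3 * t \<Longrightarrow> eqcl B (\<epsilon> ` F j) = B \<times> B"
        then have "spanning_system V ends t \<S> \<epsilon> F" by unfold_locales
        then show ?thesis by (rule that)
      qed
      interpret spanning_system V ends t \<S> \<epsilon> F by (rule sys)
      have "M * ?\<Delta> \<le> card B * ?\<Delta>" using card_V_le[of ?\<Delta>] deg G by (meson le_trans)
      then have MB: "M \<le> card B" using assms by simp
      obtain z where z: "bij_betw z {..<card B} B"
        using ex_bij_betw_nat_finite[OF finB] by (auto simp: atLeast0LessThan)
      have zM: "inj_on z {..<M}" "z ` {..<M} \<subseteq> B"
        using z MB unfolding bij_betw_def by (auto intro: inj_on_subset)
      have "\<forall>j<3 * t. sym (adj j) \<and> linked (adj j) B \<and>
          (\<forall>x. finite {y. (x, y) \<in> adj j} \<and> card {y. (x, y) \<in> adj j} \<le> ?\<Delta>)"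
        using sym_adj linked_adj adj_degree deg by (meson le_trans)
      from M[OF this finB zM] obtain g where g: "strict_mono_on {..<r} g" "g ` {..<r} \<subseteq> {..<M}"
        "\<forall>j<3 * t. combed (adj j) (z \<circ> g) r" by blast
      have "inj_on (z \<circ> g) {..<r}"
        by (rule comp_inj_on[OF strict_mono_on_imp_inj_on[OF g(1)] inj_on_subset[OF zM(1) g(2)]])
      then show ?thesis
        unfolding ends(2) using minor_of_combs[OF assms(2), of "z \<circ> g"] g(2,3) zM(2) by auto
    qed
  qed
qed

end
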